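(* Let $\varepsilon>0$, let $\mathbb{D}_\varepsilon^{*}=\{z\in\mathbb{C}: 0<|z|<\varepsilon\}$, and let $\psi:\mathbb{D}_\varepsilon^{*}\to\mathbb{C}\times\mathbb{R}=\mathbb{R}^3$ be an improper affine sphere which is complete at $0$. Then the end $0$ is an embedded end if and only if $\psi$ is asymptotic to one of the type-P end, the type-R end, or the type-NR end.
   Context: **Improper affine fronts and spheres.** Let $\Sigma$ be a Riemann surface and let $F,G:\Sigma\to\mathbb{C}$ be holomorphic functions with $(dF,dG)\neq(0,0)$ everywhere, satisfying the period condition $\mathrm{Re}\int_\gamma F\,dG=0$ for every closed curve $\gamma$ in $\Sigma$. The map $$\psi=\Big(G+\overline{F},\ \tfrac12(|G|^2-|F|^2)+\mathrm{Re}\big(GF-2\int F\,dG\big)\Big):\Sigma\to\mathbb{C}\times\mathbb{R}=\mathbb{R}^3$$ is called an improper affine front (improper affine map) with Weierstrass data $(F,G)$. It is an improper affine sphere if moreover $|dF|\neq|dG|$ everywhere on $\Sigma$. The flat fundamental form is $ds^2=|dF|^2+|dG|^2+dF\,dG+\overline{dF\,dG}$, i.e. the pull-back of the Euclidean metric of $\mathbb{C}=\mathbb{R}^2$ by $\overline F+G$. **Setting.** An improper affine front on $\Sigma$ is complete if there is a symmetric bilinear form $T$ with compact support such that $T+ds^2$ is a complete Riemannian metric on $\Sigma$; then $\Sigma$ is biholomorphic to a compact Riemann surface minus finitely many points (the ends), and $F,G$ extend meromorphically to the ends. Here $\psi$ on $\mathbb{D}_\varepsilon^*$ is the local expression of a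 complete improper affine front in a sufficiently small complex coordinate neighborhood centered at an end, where $ds^2$ is non-degenerate. **Completeness at 0, embedded end.** $\psi$ on $\mathbb{D}_\varepsilon^*$ is complete at $0$ if the $ds^2$-length of every path in $\mathbb{D}_\varepsilon^*$ accumulating to $0$ is infinite. The end $0$ is embedded if there is a small neighborhood $U$ of $0$ such that $\psi|_{U\setminus\{0\}}$ is an embedding. **Model surfaces** (given by Weierstrass data). - Elliptic paraboloid, on $(\mathbb{C}\cup\{\infty\})\setminus\{0\}$: $F=1/z$, $G=b/z$ with $b\in\mathbb{C}$, $|b|\neq1$. - Rotational improper affine front, on $\mathbb{C}\setminus\{0\}$: $F=1/z$, $G=az$ with $a\in\mathbb{R}\setminus\{0\}$. - Non-rotational improper affine front, on $\mathbb{C}\setminus\{0\}$: $F=1/z$, $G=az+b/z$ with $a\in\mathbb{R}\setminus\{0\}$, $b\in\mathbb{C}\setminus\{0\}$, $|b|\neq1$. **Asymptoticity.** An improper affine sphere $\psi:\mathbb{D}_\varepsilon^*\to\mathbb{C}\times\mathbb{R}$ which is complete at $0$ is asymptotic to a type-P end (resp. type-R end, type-NR end) if there exists a piece $\widetilde\psi:\mathbb{D}_\varepsilon^*\to\mathbb{C}\times\mathbb{R}$ of an elliptic paraboloid (resp. a rotational improper affine front, a non-rotational improper affine front) which is complete at $0$ such that $|\psi(z)-\widetilde\psi(z)|=o(1)$, where $o(1)$ denotes terms tending to $0$ as $z\to0$ and $|\cdot|$ is the standard Euclidean norm of $\mathbb{R}^3$.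
   Formalization: The model surfaces are taken up to rigid motions preserving the vertical direction (literally placed, F=0, G=1/z is a counterexample), and the piece of the model is a holomorphic injective reparametrization on a possibly smaller punctured disc. *)

theory Defs
  imports "HOL-Complex_Analysis.Complex_Analysis"
begin

definition punctured_disc :: "real \<Rightarrow> complex set" where
  "punctured_disc \<epsilon> = ball 0 \<epsilon> - {0}"

text \<open>
  The primitive of \<open>F dG\<close> in the height function is written as a contour integral from a base point
  plus a constant of integration \<open>c\<close>; only its real part is single-valued.
\<close>

definition improper_affine_front ::
  "complex set \<Rightarrow> (complex \<Rightarrow> complex) \<Rightarrow> (complex \<Rightarrow> complex) \<Rightarrow> (complex \<Rightarrow> complex \<times> real) \<Rightarrow> bool"
where
  "improper_affine_front S F G \<psi> \<longleftrightarrow>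
     open S \<and> connected S \<and> F holomorphic_on S \<and> G holomorphic_on S \<and>
     (\<forall>z\<in>S. deriv F z \<noteq> 0 \<or> deriv G z \<noteq> 0) \<and>
     (\<forall>\<gamma>. valid_path \<gamma> \<and> path_image \<gamma> \<subseteq> S \<and> pathfinish \<gamma> = pathstart \<gamma> \<longrightarrow>
        Re (contour_integral \<gamma> (\<lambda>z. F z * deriv G z)) = 0) \<and>
     (\<exists>z\<^sub>0\<in>S. \<exists>c. \<forall>\<gamma>. valid_path \<gamma> \<and> path_image \<gamma> \<subseteq> S \<and> pathstart \<gamma> = z\<^sub>0 \<longrightarrow>
        (let z = pathfinish \<gamma>; I = c + contour_integral \<gamma> (\<lambda>z. F z * deriv G z) in
          \<psi> z = (G z + cnj (F z),
                 1/2 * ((cmod (G z))\<^sup>2 - (cmod (F z))\<^sup>2) + Re (G z * F z - 2 * I))))"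

definition improper_affine_sphere ::
  "complex set \<Rightarrow> (complex \<Rightarrow> complex) \<Rightarrow> (complex \<Rightarrow> complex) \<Rightarrow> (complex \<Rightarrow> complex \<times> real) \<Rightarrow> bool"
where
  "improper_affine_sphere S F G \<psi> \<longleftrightarrow>
     improper_affine_front S F G \<psi> \<and> (\<forall>z\<in>S. cmod (deriv F z) \<noteq> cmod (deriv G z))"

text \<open>The length of the tangent vector \<open>v\<close> at \<open>z\<close> with respect to the flat fundamental form.\<close>

definition flat_length ::
  "(complex \<Rightarrow> complex) \<Rightarrow> (complex \<Rightarrow> complex) \<Rightarrow> complex \<Rightarrow> complex \<Rightarrow> real"
where
  "flat_length F G z v =
     (let dF = deriv F z * v; dG = deriv G z * v in
       sqrt ((cmod dF)\<^sup>2 + (cmod dG)\<^sup>2 + Re (dF * dG + cnj (dF * dG))))"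

text \<open>
  Paths accumulating to the puncture are half-open paths on \<open>[0,1)\<close>, piecewise \<open>C\<^sup>1\<close> on every
  compact subinterval; the puncture is a cluster point of the path, which need not converge to it.
\<close>

definition complete_at_0 ::
  "real \<Rightarrow> (complex \<Rightarrow> complex) \<Rightarrow> (complex \<Rightarrow> complex) \<Rightarrow> bool"
where
  "complete_at_0 \<epsilon> F G \<longleftrightarrow>
     (\<forall>\<gamma> :: real \<Rightarrow> complex.
        (\<forall>s. 0 < s \<and> s < 1 \<longrightarrow> \<gamma> piecewise_C1_differentiable_on {0..s}) \<and>
        \<gamma> ` {0..<1} \<subseteq> punctured_disc \<epsilon> \<and> 0 islimpt \<gamma> ` {0..<1} \<longrightarrow>
        (\<integral>\<^sup>+ t \<in> {0..<1}. ennreal (flat_length F G (\<gamma> t) (vector_derivative \<gamma> (at t))) \<partial>lborel) = \<infinity>)"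

definition embedded_end :: "real \<Rightarrow> (complex \<Rightarrow> complex \<times> real) \<Rightarrow> bool" where
  "embedded_end \<epsilon> \<psi> \<longleftrightarrow>
     (\<exists>U. open U \<and> 0 \<in> U \<and> U \<subseteq> ball 0 \<epsilon> \<and>
        embedding_map (top_of_set (U - {0})) euclidean \<psi> \<and>
        (\<forall>z\<in>U - {0}. \<exists>D. (\<psi> has_derivative D) (at z) \<and> inj D))"

text \<open>
  The model surfaces are surfaces in \<open>\<real>\<^sup>3\<close>, considered up to the orientation-preserving rigid motions
  that respect the vertical direction (the affine normal).  Placing the models only at the position
  given by their literal Weierstrass data would make the characterization false.  The data
  \<open>F = 1/z\<close>, \<open>G = 1\<close> describe an elliptic paraboloid differing from the model with \<open>b = 0\<close> by a
  horizontal translation, and \<open>F = 0\<close>, \<open>G = 1/z\<close> describe the same paraboloid turned upside down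
  (exchanging \<open>F\<close> and \<open>G\<close> is the half-turn \<open>(x, t) \<mapsto> (cnj x, - t)\<close>); neither is asymptotic to a
  model in its literal position.
\<close>

definition vertical_motion :: "(complex \<times> real \<Rightarrow> complex \<times> real) \<Rightarrow> bool" where
  "vertical_motion T \<longleftrightarrow>
     (\<exists>u v c. cmod u = 1 \<and>
        (T = (\<lambda>(x, t). (u * x + v, t + c)) \<or> T = (\<lambda>(x, t). (u * cnj x + v, - t + c))))"

text \<open>
  \<open>T \<circ> \<Psi> \<circ> \<phi>\<close> is the piece of the surface with Weierstrass data \<open>(F, G)\<close>, where \<open>\<phi>\<close> is an injective
  holomorphic parametrization of a part of the surface.  Its flat fundamental form is that of the
  data \<open>(F \<circ> \<phi>, G \<circ> \<phi>)\<close>, since motions as above leave this form unchanged.  Asymptoticity is a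
  property of the germ at the puncture, so \<open>\<phi>\<close> is only required on some smaller punctured disc: an
  injective \<open>\<phi>\<close> with the right asymptotics need not exist on a prescribed disc (area theorem).
  As the disc may be shrunk, the regular point \<open>\<infinity>\<close> of the elliptic paraboloid is never needed in
  the image of \<open>\<phi>\<close>, and all models are written on \<open>- {0}\<close>.
\<close>

definition asymptotic_to ::
  "real \<Rightarrow> (complex \<Rightarrow> complex \<times> real) \<Rightarrow> (complex \<Rightarrow> complex) \<Rightarrow> (complex \<Rightarrow> complex) \<Rightarrow> bool"
where
  "asymptotic_to \<epsilon> \<psi> F G \<longleftrightarrow>
     (\<exists>\<Psi> T \<delta> \<phi>.
        improper_affine_front (- {0}) F G \<Psi> \<and> vertical_motion T \<and>
        0 < \<delta> \<and> \<delta> \<le> \<epsilon> \<and>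
        \<phi> holomorphic_on punctured_disc \<delta> \<and> inj_on \<phi> (punctured_disc \<delta>) \<and>
        \<phi> ` punctured_disc \<delta> \<subseteq> - {0} \<and>
        complete_at_0 \<delta> (F \<circ> \<phi>) (G \<circ> \<phi>) \<and>
        ((\<lambda>z. norm (\<psi> z - T (\<Psi> (\<phi> z)))) \<longlongrightarrow> 0) (at 0))"

definition asymptotic_to_P :: "real \<Rightarrow> (complex \<Rightarrow> complex \<times> real) \<Rightarrow> bool" where
  "asymptotic_to_P \<epsilon> \<psi> \<longleftrightarrow>
     (\<exists>b. cmod b \<noteq> 1 \<and> asymptotic_to \<epsilon> \<psi> (\<lambda>z. 1 / z) (\<lambda>z. b / z))"

definition asymptotic_to_R :: "real \<Rightarrow> (complex \<Rightarrow> complex \<times> real) \<Rightarrow> bool" where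
  "asymptotic_to_R \<epsilon> \<psi> \<longleftrightarrow>
     (\<exists>a::real. a \<noteq> 0 \<and> asymptotic_to \<epsilon> \<psi> (\<lambda>z. 1 / z) (\<lambda>z. of_real a * z))"

definition asymptotic_to_NR :: "real \<Rightarrow> (complex \<Rightarrow> complex \<times> real) \<Rightarrow> bool" where
  "asymptotic_to_NR \<epsilon> \<psi> \<longleftrightarrow>
     (\<exists>(a::real) b. a \<noteq> 0 \<and> b \<noteq> 0 \<and> cmod b \<noteq> 1 \<and>
        asymptotic_to \<epsilon> \<psi> (\<lambda>z. 1 / z) (\<lambda>z. of_real a * z + b / z))"

end

theory Submission
  imports Defs
begin

text \<open>
  Exchanging \<open>F\<close> and \<open>G\<close> turns the surface by a half-turn, so one may assume \<open>|G'| < |F'|\<close>.  Then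
  completeness and the maximum principle give \<open>F = f / z^n\<close> and \<open>G = g / z^n\<close> with \<open>n \<ge> 1\<close> and
  \<open>|g(0)| < |f(0)|\<close>, and both sides of the equivalence amount to \<open>n = 1\<close>.

  The horizontal part \<open>x = G + cnj F\<close> covers a neighbourhood of infinity \<open>n\<close> times.  If \<open>n = 1\<close>, it is
  injective near the end and the surface is a graph.  If \<open>n \<ge> 2\<close>, the height along the lift of a
  loop around infinity is a \<open>2\<pi>n\<close>-periodic function \<open>\<tau>\<close>; summing \<open>\<tau>(\<theta> + 2\<pi>) - \<tau>(\<theta>)\<close> over the \<open>n\<close> sheets
  gives zero, so this difference vanishes somewhere and the surface meets itself.

  For \<open>n = 1\<close> the pair \<open>(F + d, G + cnj d)\<close> describes a translate of the surface, and \<open>d\<close> can be chosen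
  such that \<open>G - b F\<close> tends to \<open>0\<close> for \<open>b = g(0) / f(0)\<close>.  In the coordinate \<open>\<phi> = 1 / F\<close> this gives
  \<open>G = b / \<phi> + a \<phi> + O(\<phi>^2)\<close>, where \<open>a\<close> is real by the period condition; this is a model surface up
  to \<open>o(1)\<close>.  Conversely, the parametrization \<open>\<phi>\<close> of a model is injective, so \<open>\<phi>\<close> and \<open>1 / \<phi>\<close> are
  \<open>O(1/|z|)\<close>, whence \<open>x = O(1/|z|)\<close> and \<open>n = 1\<close>.
\<close>

text \<open>The models are treated as the one family \<open>G = a z + b / z\<close> with
  \<open>cmod b \<noteq> 1\<close>: \<open>a = 0\<close> is type P, \<open>b = 0\<close> with
  \<open>a \<noteq> 0\<close> is type R, and the rest is type NR.

  Two obstacles shape the estimates. The horizontal part \<open>x = G + cnj F\<close> is not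
  holomorphic, so its n-sheeted behaviour cannot be read off an n-th root coordinate. As
  \<open>G - (g(0) / f(0)) F\<close> has lower order, \<open>x\<close> is instead a perturbation of
  the real-linear map \<open>y \<mapsto> cnj y + (g(0) / f(0)) y\<close> applied to
  \<open>F\<close>; the strict inequality |g(0)| < |f(0)| makes that map invertible, and a fixed
  point argument does the rest. Secondly, the height contains \<open>G F\<close> with
  \<open>F\<close> of order 1/z, so that an error in \<open>G\<close> disappears from the height
  only if it is o(z). Hence \<open>G\<close> has to be matched up to its linear term: the constant
  term goes into a translation, the linear one into the parameter \<open>a\<close>. The way back
  needs no heights: there the growth of the horizontal part alone determines
  \<open>n\<close>.\<close>

section \<open>The height function and the model surfaces\<close>

text \<open>\<open>R\<close> plays the role of the single-valued function \<open>Re (\<integral> F dG)\<close>.\<close>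

definition affine_rep ::
  "complex set \<Rightarrow> (complex \<Rightarrow> complex) \<Rightarrow> (complex \<Rightarrow> complex) \<Rightarrow> (complex \<Rightarrow> complex \<times> real) \<Rightarrow>
    (complex \<Rightarrow> real) \<Rightarrow> bool"
where
  "affine_rep S F G \<psi> R \<longleftrightarrow>
     (\<forall>z\<in>S. \<psi> z = (G z + cnj (F z),
                 1/2 * ((cmod (G z))\<^sup>2 - (cmod (F z))\<^sup>2) + Re (G z * F z) - 2 * R z) \<and>
        (R has_derivative (\<lambda>v. Re (F z * deriv G z * v))) (at z))"

lemma Re_has_derivative:
  assumes "(K has_field_derivative D) (at z within A)"
  shows "((\<lambda>z. Re (K z)) has_derivative (\<lambda>v. Re (D * v))) (at z within A)"
  using assms by (auto simp: has_field_derivative_def intro!: derivative_eq_intros)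

text \<open>Any path to \<open>z\<close> may be prolonged by a short segment, and along the segment
  the integral changes like a local primitive \<open>K\<close> of \<open>F G'\<close>; so
  \<open>R\<close> is locally the real part of a holomorphic function.\<close>

lemma affine_rep_of_front:
  assumes "improper_affine_front S F G \<psi>"
  obtains R where "affine_rep S F G \<psi> R"
proof -
  have S: "open S" "connected S" and holF: "F holomorphic_on S" and holG: "G holomorphic_on S"
    using assms unfolding improper_affine_front_def by auto
  obtain z\<^sub>0 c where z0: "z\<^sub>0 \<in> S" and
    \<psi>: "\<And>\<gamma>. valid_path \<gamma> \<Longrightarrow> path_image \<gamma> \<subseteq> S \<Longrightarrow> pathstart \<gamma> = z\<^sub>0 \<Longrightarrow>
        (let z = pathfinish \<gamma>; I = c + contour_integral \<gamma> (\<lambda>z. F z * deriv G z) in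
          \<psi> z = (G z + cnj (F z),
                 1/2 * ((cmod (G z))\<^sup>2 - (cmod (F z))\<^sup>2) + Re (G z * F z - 2 * I)))"
    using assms unfolding improper_affine_front_def by blast
  let ?f = "\<lambda>z. F z * deriv G z"
  have hol: "?f holomorphic_on S"
    using S holF holG by (intro holomorphic_intros)
  \<comment> \<open>\<open>R\<close> is read off from the height of the surface, which makes the
    height formula true by definition; its derivative is the point to prove.\<close>
  define R where "R z = (1/2 * ((cmod (G z))\<^sup>2 - (cmod (F z))\<^sup>2) + Re (G z * F z) - snd (\<psi> z)) / 2" for z
  have "\<psi> z = (G z + cnj (F z),
                 1/2 * ((cmod (G z))\<^sup>2 - (cmod (F z))\<^sup>2) + Re (G z * F z) - 2 * R z) \<and>
        (R has_derivative (\<lambda>v. Re (?f z * v))) (at z)" if z: "z \<in> S" for z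
  proof -
    obtain r where r: "r > 0" "ball z r \<subseteq> S"
      using S z by (meson open_contains_ball)
    obtain p where p: "polynomial_function p" "path_image p \<subseteq> S" "pathstart p = z\<^sub>0" "pathfinish p = z"
      using connected_open_polynomial_connected[OF S z0 z] by blast
    have vp: "valid_path p" using p(1) by (rule valid_path_polynomial_function)
    obtain K where K: "\<And>y. y \<in> ball z r \<Longrightarrow> (K has_field_derivative ?f y) (at y within ball z r)"
      using holomorphic_convex_primitive'[of "ball z r" ?f] hol r(2)
      by (meson convex_ball holomorphic_on_subset open_ball)
    have main: "fst (\<psi> y) = G y + cnj (F y) \<and>
       R y = Re (c + contour_integral p ?f + K y - K z)" if y: "y \<in> ball z r" for y
    proof -
      have seg: "closed_segment z y \<subseteq> ball z r"
        by (meson centre_in_ball closed_segment_subset convex_ball r(1) y)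
      let ?\<gamma> = "p +++ linepath z y"
      have vl: "valid_path (linepath z y)" by simp
      have vg: "valid_path ?\<gamma>" using vp p by simp
      have img: "path_image ?\<gamma> \<subseteq> S"
        using p seg r(2) by (auto simp: path_image_join)
      have int1: "?f contour_integrable_on p"
        using contour_integrable_holomorphic_simple[OF hol S(1) vp p(2)] .
      have c2: "(?f has_contour_integral (K y - K z)) (linepath z y)"
        using contour_integral_primitive[of "ball z r" K ?f "linepath z y"] K seg by simp
      have eq: "contour_integral ?\<gamma> ?f = contour_integral p ?f + (K y - K z)"
        using c2 int1 vp by (intro contour_integral_unique has_contour_integral_join)
          (auto simp: has_contour_integral_integral)
      have "fst (\<psi> y) = G y + cnj (F y) \<and> R y = Re (c + contour_integral ?\<gamma> ?f)"
        using \<psi>[OF vg img] p unfolding R_def Let_def by simp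
      then show ?thesis unfolding eq by (simp add: algebra_simps)
    qed
    have zb: "z \<in> ball z r" using r by simp
    have "((\<lambda>y. c + contour_integral p ?f + K y - K z) has_field_derivative ?f z) (at z)"
      using K[OF zb, unfolded at_within_open[OF zb open_ball]] by (auto intro!: derivative_eq_intros)
    from Re_has_derivative[OF this]
    have "((\<lambda>y. Re (c + contour_integral p ?f + K y - K z)) has_derivative (\<lambda>v. Re (?f z * v))) (at z)" .
    then have "(R has_derivative (\<lambda>v. Re (?f z * v))) (at z)"
      by (rule has_derivative_transform_within_open[OF _ open_ball zb]) (rule main[THEN conjunct2, symmetric])
    moreover have "\<psi> z = (G z + cnj (F z),
                 1/2 * ((cmod (G z))\<^sup>2 - (cmod (F z))\<^sup>2) + Re (G z * F z) - 2 * R z)"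
      using main[OF zb, THEN conjunct1] unfolding R_def by (simp add: prod_eq_iff field_simps)
    ultimately show ?thesis by blast
  qed
  then show ?thesis
    using that unfolding affine_rep_def by blast
qed

text \<open>Exchanging \<open>F\<close> and \<open>G\<close> amounts to this half-turn; integration by parts takes care of the height.\<close>

definition flip :: "complex \<times> real \<Rightarrow> complex \<times> real" where
  "flip = (\<lambda>(x, t). (cnj x, - t))"

lemma flip_simps [simp]: "flip (x, t) = (cnj x, - t)" "flip (flip p) = p"
  by (auto simp: flip_def split: prod.splits)

lemma bounded_linear_flip: "bounded_linear flip"
proof -
  have eq: "flip = (\<lambda>p. (cnj (fst p), - snd p))" by (auto simp: flip_def)
  show ?thesis
    unfolding eq
    by (intro bounded_linear_Pair bounded_linear_minus bounded_linear_snd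
        bounded_linear_compose[OF bounded_linear_cnj bounded_linear_fst])
qed

lemma affine_rep_flip:
  assumes "affine_rep S F G \<psi> R" "open S" "F holomorphic_on S" "G holomorphic_on S"
  shows "affine_rep S G F (flip \<circ> \<psi>) (\<lambda>z. Re (F z * G z) - R z)"
  unfolding affine_rep_def
proof (intro ballI conjI)
  fix z assume z: "z \<in> S"
  have R: "(R has_derivative (\<lambda>v. Re (F z * deriv G z * v))) (at z)"
    and \<psi>: "\<psi> z = (G z + cnj (F z),
                 1/2 * ((cmod (G z))\<^sup>2 - (cmod (F z))\<^sup>2) + Re (G z * F z) - 2 * R z)"
    using assms(1) z unfolding affine_rep_def by blast+
  show "(flip \<circ> \<psi>) z = (F z + cnj (G z),
     1 / 2 * ((cmod (F z))\<^sup>2 - (cmod (G z))\<^sup>2) + Re (F z * G z) - 2 * (Re (F z * G z) - R z))"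
    by (simp add: \<psi> algebra_simps)
  have "((\<lambda>z. F z * G z) has_field_derivative (F z * deriv G z + deriv F z * G z)) (at z)"
    using assms z by (intro DERIV_mult' holomorphic_derivI[of _ S])
  from has_derivative_diff[OF Re_has_derivative[OF this] R]
  show "((\<lambda>z. Re (F z * G z) - R z) has_derivative (\<lambda>v. Re (G z * deriv F z * v))) (at z)"
    by (simp add: algebra_simps)
qed

text \<open>Adding \<open>d\<close> to \<open>F\<close> and \<open>e\<close> to \<open>G\<close> shears the surface vertically unless \<open>e = cnj d\<close>.\<close>

lemma affine_rep_translate:
  assumes "affine_rep S F G \<psi> R" "open S" "F holomorphic_on S" "G holomorphic_on S"
  shows "affine_rep S (\<lambda>z. F z + d) (\<lambda>z. G z + cnj d) (\<lambda>z. \<psi> z + (2 * cnj d, (cmod d)\<^sup>2))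
           (\<lambda>z. R z + Re (d * G z))"
  unfolding affine_rep_def
proof (intro ballI conjI)
  fix z assume z: "z \<in> S"
  have R: "(R has_derivative (\<lambda>v. Re (F z * deriv G z * v))) (at z)"
    and \<psi>: "\<psi> z = (G z + cnj (F z),
                 1/2 * ((cmod (G z))\<^sup>2 - (cmod (F z))\<^sup>2) + Re (G z * F z) - 2 * R z)"
    using assms(1) z unfolding affine_rep_def by blast+
  show "\<psi> z + (2 * cnj d, (cmod d)\<^sup>2) = (G z + cnj d + cnj (F z + d),
     1 / 2 * ((cmod (G z + cnj d))\<^sup>2 - (cmod (F z + d))\<^sup>2) + Re ((G z + cnj d) * (F z + d)) -
       2 * (R z + Re (d * G z)))"
    unfolding \<psi> cmod_power2 by (simp add: algebra_simps power2_eq_square)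
  have G: "(G has_field_derivative deriv G z) (at z)"
    using assms z by (intro holomorphic_derivI[of _ S])
  then have "((\<lambda>z. G z + cnj d) has_field_derivative deriv G z) (at z)"
    by (auto intro!: derivative_eq_intros)
  then have 1: "deriv (\<lambda>z. G z + cnj d) z = deriv G z"
    by (rule DERIV_imp_deriv)
  from has_derivative_add[OF R Re_has_derivative[OF DERIV_cmult[OF G, of d]]]
  show "((\<lambda>z. R z + Re (d * G z)) has_derivative
     (\<lambda>v. Re ((F z + d) * deriv (\<lambda>z. G z + cnj d) z * v))) (at z)"
    unfolding 1 by (simp add: algebra_simps)
qed

section \<open>Real parts of primitives and the model surfaces\<close>

lemma has_derivative_eq_imp_constant_difference:
  assumes "connected S" "open S"
    and "\<And>z. z \<in> S \<Longrightarrow> (R has_derivative D z) (at z)"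
    and "\<And>z. z \<in> S \<Longrightarrow> (R' has_derivative D z) (at z)"
  obtains c :: real where "\<And>z::complex. z \<in> S \<Longrightarrow> R z = R' z + c"
proof (cases "S = {}")
  case False
  then obtain a where a: "a \<in> S" by blast
  have "((\<lambda>z. R z - R' z) has_derivative (\<lambda>v. 0)) (at z)" if "z \<in> S" for z
    using has_derivative_diff[OF assms(3,4)[OF that]] by simp
  then have "R z - R' z = R a - R' a" if "z \<in> S" for z
    using has_derivative_zero_unique_connected[OF assms(2,1), of "\<lambda>z. R z - R' z" ] a that 
    by (metis (mono_tags, lifting) has_derivative_at_withinI)
  then show ?thesis using that[of "R a - R' a"] by (simp add: algebra_simps)
qed (use that in auto)

text \<open>\<open>exp\<close> of 2\<pi>i times the winding number is the quotient of the endpoints,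
  also for a path that is not closed. Passing to moduli removes the ambiguity of the
  logarithm.\<close>

lemma Re_contour_integral_inverse:
  assumes "valid_path \<gamma>" "path_image \<gamma> \<subseteq> - {0}"
  shows "Re (contour_integral \<gamma> (\<lambda>z. 1 / z)) = ln (cmod (pathfinish \<gamma>)) - ln (cmod (pathstart \<gamma>))"
proof -
  have 0: "0 \<notin> path_image \<gamma>" using assms(2) by auto
  have nz: "pathstart \<gamma> \<noteq> 0" "pathfinish \<gamma> \<noteq> 0"
    using 0 by (metis pathstart_in_path_image, metis pathfinish_in_path_image)
  have "contour_integral \<gamma> (\<lambda>z. 1 / z) = 2 * of_real pi * \<i> * winding_number \<gamma> 0"
    using winding_number_valid_path[OF assms(1) 0] by simp
  moreover have "exp (2 * of_real pi * \<i> * winding_number \<gamma> 0) = pathfinish \<gamma> / pathstart \<gamma>"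
    using winding_number_exp_2pi[OF valid_path_imp_path[OF assms(1)] 0] nz by simp
  ultimately have "exp (contour_integral \<gamma> (\<lambda>z. 1 / z)) = pathfinish \<gamma> / pathstart \<gamma>"
    by simp
  then have "exp (Re (contour_integral \<gamma> (\<lambda>z. 1 / z))) = cmod (pathfinish \<gamma>) / cmod (pathstart \<gamma>)"
    by (metis norm_divide norm_exp_eq_Re)
  then have "Re (contour_integral \<gamma> (\<lambda>z. 1 / z)) = ln (cmod (pathfinish \<gamma>) / cmod (pathstart \<gamma>))"
    by (metis ln_exp)
  then show ?thesis using nz by (simp add: ln_div)
qed

text \<open>For the models \<open>F G' = a / z - b / z^3\<close>, with primitive
  \<open>a log z + b / (2 z^2)\<close>. Because \<open>a\<close> is real, the real part of the
  primitive is single-valued. One statement serves all three types.\<close>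

lemma model_front:
  fixes a :: real and b :: complex
  obtains \<Psi> where "improper_affine_front (- {0}) (\<lambda>z. 1 / z) (\<lambda>z. of_real a * z + b / z) \<Psi>"
proof -
  define F :: "complex \<Rightarrow> complex" where "F = (\<lambda>z. 1 / z)"
  define G where "G = (\<lambda>z. of_real a * z + b / z)"
  define B where "B z = b / (2 * z\<^sup>2)" for z
  define \<Psi> where "\<Psi> z = (G z + cnj (F z),
      1/2 * ((cmod (G z))\<^sup>2 - (cmod (F z))\<^sup>2) + Re (G z * F z) - 2 * (a * ln (cmod z) + Re (B z)))" for z
  have dF: "deriv F z = - (1 / z\<^sup>2)" if "z \<noteq> 0" for z
    unfolding F_def by (rule DERIV_imp_deriv)
      (use that in \<open>auto intro!: derivative_eq_intros simp: field_simps power2_eq_square\<close>)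
  have dG: "deriv G z = of_real a - b / z\<^sup>2" if "z \<noteq> 0" for z
    unfolding G_def by (rule DERIV_imp_deriv)
      (use that in \<open>auto intro!: derivative_eq_intros simp: field_simps power2_eq_square\<close>)
  have dB: "(B has_field_derivative - (b / z ^ 3)) (at z within A)" if "z \<noteq> 0" for z A
    unfolding B_def
    by (use that in \<open>auto intro!: derivative_eq_intros simp: field_simps power2_eq_square power3_eq_cube\<close>)
  have FG: "F z * deriv G z = of_real a * (1 / z) + - (b / z ^ 3)" if "z \<noteq> 0" for z
    using that by (simp add: dG F_def field_simps power2_eq_square power3_eq_cube)
  have int: "Re (contour_integral \<gamma> (\<lambda>z. F z * deriv G z)) =
      (a * ln (cmod (pathfinish \<gamma>)) + Re (B (pathfinish \<gamma>))) -
      (a * ln (cmod (pathstart \<gamma>)) + Re (B (pathstart \<gamma>)))"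
    if \<gamma>: "valid_path \<gamma>" "path_image \<gamma> \<subseteq> - {0}" for \<gamma>
  proof -
    have "((\<lambda>z. - (b / z ^ 3)) has_contour_integral (B (pathfinish \<gamma>) - B (pathstart \<gamma>))) \<gamma>"
      using contour_integral_primitive[of "- {0}" B "\<lambda>z. - (b / z ^ 3)" \<gamma>] dB \<gamma> by auto
    moreover have "(\<lambda>z. 1 / z) contour_integrable_on \<gamma>"
      using \<gamma> by (intro contour_integrable_holomorphic_simple[of _ "- {0}"] holomorphic_intros) auto
    then have "((\<lambda>z. of_real a * (1 / z)) has_contour_integral (of_real a * contour_integral \<gamma> (\<lambda>z. 1 / z))) \<gamma>"
      by (intro has_contour_integral_lmul) (simp add: has_contour_integral_integral)
    ultimately have "((\<lambda>z. of_real a * (1 / z) + - (b / z ^ 3)) has_contour_integral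
       (of_real a * contour_integral \<gamma> (\<lambda>z. 1 / z) + (B (pathfinish \<gamma>) - B (pathstart \<gamma>)))) \<gamma>"
      by (intro has_contour_integral_add)
    moreover have "contour_integral \<gamma> (\<lambda>z. F z * deriv G z) =
        contour_integral \<gamma> (\<lambda>z. of_real a * (1 / z) + - (b / z ^ 3))"
      by (rule contour_integral_cong[OF refl], rule FG) (use \<gamma>(2) in auto)
    ultimately have "contour_integral \<gamma> (\<lambda>z. F z * deriv G z) =
        of_real a * contour_integral \<gamma> (\<lambda>z. 1 / z) + (B (pathfinish \<gamma>) - B (pathstart \<gamma>))"
      by (simp add: contour_integral_unique)
    then have "Re (contour_integral \<gamma> (\<lambda>z. F z * deriv G z)) =
        a * Re (contour_integral \<gamma> (\<lambda>z. 1 / z)) + (Re (B (pathfinish \<gamma>)) - Re (B (pathstart \<gamma>)))"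
      by simp
    then show ?thesis
      unfolding Re_contour_integral_inverse[OF \<gamma>] by (simp add: algebra_simps)
  qed
  have "improper_affine_front (- {0}) F G \<Psi>"
    unfolding improper_affine_front_def
  proof (intro conjI)
    show "connected (- {0::complex})"
      by (rule connected_punctured_universe) simp
    show "F holomorphic_on - {0}" "G holomorphic_on - {0}"
      unfolding F_def G_def by (auto intro!: holomorphic_intros)
    show "\<exists>z\<^sub>0\<in>- {0}. \<exists>c. \<forall>\<gamma>. valid_path \<gamma> \<and> path_image \<gamma> \<subseteq> - {0} \<and> pathstart \<gamma> = z\<^sub>0 \<longrightarrow>
       (let z = pathfinish \<gamma>; I = c + contour_integral \<gamma> (\<lambda>z. F z * deriv G z) in
          \<Psi> z = (G z + cnj (F z),
                 1/2 * ((cmod (G z))\<^sup>2 - (cmod (F z))\<^sup>2) + Re (G z * F z - 2 * I)))"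
      \<comment> \<open>The base point is 1, where the logarithm is 0; the constant of integration
        is therefore \<open>B 1\<close>.\<close>
      by (intro bexI[of _ 1] exI[of _ "B 1"]) (auto simp: Let_def \<Psi>_def int)
  qed (auto simp: dF int)
  then show ?thesis using that unfolding F_def G_def by blast
qed

section \<open>Completeness and the normal form of an end\<close>

lemma punctured_disc_iff [simp]: "z \<in> punctured_disc r \<longleftrightarrow> z \<noteq> 0 \<and> cmod z < r"
  by (auto simp: punctured_disc_def)

lemma open_punctured_disc: "open (punctured_disc r)"
  unfolding punctured_disc_def by (simp add: open_delete)

lemma connected_punctured_disc: "connected (punctured_disc r)"
  unfolding punctured_disc_def by (rule connected_punctured_ball) simp

lemma punctured_disc_mono: "r \<le> s \<Longrightarrow> punctured_disc r \<subseteq> punctured_disc s"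
  by auto

text \<open>Every large exponent is allowed, so that a common one can be chosen for \<open>F\<close>
  and \<open>G\<close>.\<close>

lemma meromorphic_at_0_factor:
  assumes "F meromorphic_on {0}" "F holomorphic_on punctured_disc \<epsilon>" "\<epsilon> > 0"
  obtains k0 :: nat where "\<And>k. k \<ge> k0 \<Longrightarrow>
     \<exists>f. f holomorphic_on ball 0 \<epsilon> \<and> (\<forall>z\<in>punctured_disc \<epsilon>. F z = f z / z ^ k)"
proof -
  obtain L where L: "F has_laurent_expansion L"
    using assms(1) unfolding meromorphic_on_def by auto
  have "\<exists>f. f holomorphic_on ball 0 \<epsilon> \<and> (\<forall>z\<in>punctured_disc \<epsilon>. F z = f z / z ^ k)"
    if k: "k \<ge> nat (- fls_subdegree L)" for k
  proof -
    have "(\<lambda>z. F z * z ^ k) has_laurent_expansion (L * fls_X_intpow k)"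
      by (intro laurent_expansion_intros L)
    moreover have "fls_subdegree (L * fls_X_intpow (int k)) \<ge> 0"
      using k by (cases "L = 0") auto
    ultimately obtain l where l: "(\<lambda>z. F z * z ^ k) \<midarrow>0\<rightarrow> l"
      using has_laurent_expansion_imp_tendsto_0 by blast
    have "(\<lambda>z. if z = 0 then l else F z * z ^ k) holomorphic_on ball 0 \<epsilon>"
      using assms(2) by (intro removable_singularity l open_ball) (auto simp: punctured_disc_def intro!: holomorphic_intros)
    then show ?thesis
      by (intro exI conjI, assumption) auto
  qed
  then show ?thesis using that by blast
qed

text \<open>The flat form is the Euclidean metric pulled back by \<open>G + cnj F\<close>, so that
  lengths are those of plane curves; both completeness arguments below rest on this.\<close>

lemma flat_length_eq: "flat_length F G z v = cmod (deriv G z * v + cnj (deriv F z * v))"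
proof -
  have "(cmod (deriv F z * v))\<^sup>2 + (cmod (deriv G z * v))\<^sup>2
     + Re (deriv F z * v * (deriv G z * v) + cnj (deriv F z * v * (deriv G z * v)))
     = (cmod (deriv G z * v + cnj (deriv F z * v)))\<^sup>2"
    unfolding cmod_power2 by (simp add: algebra_simps power2_eq_square)
  then show ?thesis unfolding flat_length_def Let_def by simp
qed

lemma complete_at_0_commute: "complete_at_0 \<epsilon> F G \<longleftrightarrow> complete_at_0 \<epsilon> G F"
proof -
  have "flat_length F G = flat_length G F"
    unfolding flat_length_def Let_def by (intro ext) (simp add: mult_ac add_ac)
  then show ?thesis unfolding complete_at_0_def by simp
qed

text \<open>The straight path from radius \<open>r\<close> to the puncture has bounded speed with
  respect to the flat form, hence finite length. This excludes \<open>n = 0\<close> in the normal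
  form.\<close>

lemma not_complete_at_0:
  assumes "f holomorphic_on ball 0 \<epsilon>" "g holomorphic_on ball 0 \<epsilon>" "\<epsilon> > 0"
    and eq: "\<And>z. z \<in> punctured_disc \<epsilon> \<Longrightarrow> F z = f z \<and> G z = g z"
  shows "\<not> complete_at_0 \<epsilon> F G"
proof
  assume complete: "complete_at_0 \<epsilon> F G"
  define r where "r = \<epsilon> / 2"
  have r: "0 < r" "r < \<epsilon>" using assms by (auto simp: r_def)
  define \<gamma> :: "real \<Rightarrow> complex" where "\<gamma> = (\<lambda>t. of_real ((1 - t) * r))"
  have vd: "(\<gamma> has_vector_derivative - of_real r) (at t)" for t
    unfolding \<gamma>_def has_vector_derivative_def
    by (auto intro!: derivative_eq_intros simp: algebra_simps scaleR_conv_of_real)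
  have pos: "\<gamma> t \<in> punctured_disc \<epsilon>" "\<gamma> t \<in> cball 0 r" if "0 \<le> t" "t < 1" for t
  proof -
    have n: "cmod (\<gamma> t) = (1 - t) * r"
      unfolding \<gamma>_def norm_of_real using that r by simp
    have "(1 - t) * r \<le> 1 * r"
      using that r by (intro mult_right_mono) auto
    with n r have n2: "cmod (\<gamma> t) \<le> r" by linarith
    have "0 < (1 - t) * r"
      using that r by simp
    with n have "\<gamma> t \<noteq> 0" by (metis norm_zero less_irrefl)
    with n2 r show "\<gamma> t \<in> punctured_disc \<epsilon>" "\<gamma> t \<in> cball 0 r"
      by auto
  qed
  obtain B where B: "\<And>z. z \<in> cball 0 r \<Longrightarrow> cmod (deriv g z) * r + cmod (deriv f z) * r \<le> B"
  proof -
    have "deriv g holomorphic_on ball 0 \<epsilon>" "deriv f holomorphic_on ball 0 \<epsilon>"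
      using assms by (auto intro: holomorphic_deriv)
    then have "continuous_on (cball 0 r) (deriv g)" "continuous_on (cball 0 r) (deriv f)"
      using r by (auto intro!: holomorphic_on_imp_continuous_on elim!: holomorphic_on_subset)
    then have "compact ((\<lambda>z. cmod (deriv g z) * r + cmod (deriv f z) * r) ` cball 0 r)"
      by (intro compact_continuous_image continuous_intros) auto
    then have "bdd_above ((\<lambda>z. cmod (deriv g z) * r + cmod (deriv f z) * r) ` cball 0 r)"
      by (simp add: bounded_imp_bdd_above compact_imp_bounded)
    then show ?thesis using that unfolding bdd_above_def by blast
  qed
  have len: "flat_length F G (\<gamma> t) (vector_derivative \<gamma> (at t)) \<le> B" if t: "0 \<le> t" "t < 1" for t
  proof -
    have ev: "eventually (\<lambda>z. z \<in> punctured_disc \<epsilon>) (nhds (\<gamma> t))"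
      using pos[OF t] open_punctured_disc eventually_nhds by blast
    have "deriv G (\<gamma> t) = deriv g (\<gamma> t)" "deriv F (\<gamma> t) = deriv f (\<gamma> t)"
      by (auto intro!: deriv_cong_ev eventually_mono[OF ev] simp: eq)
    moreover have "vector_derivative \<gamma> (at t) = - of_real r"
      using vd by (rule vector_derivative_at)
    ultimately have "flat_length F G (\<gamma> t) (vector_derivative \<gamma> (at t))
        \<le> cmod (deriv g (\<gamma> t) * - of_real r) + cmod (cnj (deriv f (\<gamma> t) * - of_real r))"
      unfolding flat_length_eq using norm_triangle_ineq by metis
    also have "\<dots> = cmod (deriv g (\<gamma> t)) * r + cmod (deriv f (\<gamma> t)) * r"
      using r by (simp add: norm_mult)
    finally show ?thesis using B[OF pos(2)[OF t]] by simp
  qed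
  have "\<gamma> piecewise_C1_differentiable_on {0..s}" for s
  proof (rule C1_differentiable_imp_piecewise)
    show "\<gamma> C1_differentiable_on {0..s}"
      unfolding C1_differentiable_on_def using vd by (intro exI[of _ "\<lambda>_. - of_real r"]) auto
  qed
  moreover have "\<gamma> ` {0..<1} \<subseteq> punctured_disc \<epsilon>"
    using pos by auto
  moreover have "0 islimpt \<gamma> ` {0..<1}"
    unfolding islimpt_approachable
  proof (intro allI impI)
    fix e :: real assume e: "e > 0"
    define t where "t = max 0 (1 - e / (2 * r))"
    have t: "0 \<le> t" "t < 1" using e r by (auto simp: t_def)
    have "(1 - t) * r \<le> e / (2 * r) * r" using r by (intro mult_right_mono) (auto simp: t_def)
    also have "\<dots> = e / 2" using r by simp
    finally have "(1 - t) * r < e" using e by simp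
    moreover have "cmod (\<gamma> t) = (1 - t) * r"
      unfolding \<gamma>_def norm_of_real using t r by simp
    ultimately show "\<exists>x'\<in>\<gamma> ` {0..<1}. x' \<noteq> 0 \<and> dist x' 0 < e"
      using t pos[OF t] by (intro bexI[of _ "\<gamma> t"]) auto
  qed
  ultimately have "(\<integral>\<^sup>+ t \<in> {0..<1}. ennreal (flat_length F G (\<gamma> t) (vector_derivative \<gamma> (at t))) \<partial>lborel) = \<infinity>"
    using complete unfolding complete_at_0_def by blast
  moreover have "(\<integral>\<^sup>+ t \<in> {0..<1}. ennreal (flat_length F G (\<gamma> t) (vector_derivative \<gamma> (at t))) \<partial>lborel)
      \<le> (\<integral>\<^sup>+ t \<in> {0..<1::real}. ennreal B \<partial>lborel)"
    by (intro nn_integral_mono) (auto simp: indicator_def intro!: ennreal_leI len)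
  moreover have "(\<integral>\<^sup>+ t \<in> {0..<1::real}. ennreal B \<partial>lborel) = ennreal B"
    by (simp add: nn_integral_cmult)
  ultimately show False by (simp add: top_unique)
qed

text \<open>The length of a path dominates the displacement of its image under
  \<open>G + cnj F\<close>, and the image is unbounded as soon as the path has 0 as a cluster
  point.\<close>

lemma complete_at_0I:
  assumes holF: "F holomorphic_on punctured_disc \<delta>" and holG: "G holomorphic_on punctured_disc \<delta>"
    and lim: "filterlim (\<lambda>z. cmod (G z + cnj (F z))) at_top (at 0)"
  shows "complete_at_0 \<delta> F G"
  unfolding complete_at_0_def
proof (intro allI impI)
  fix \<gamma> :: "real \<Rightarrow> complex"
  let ?X = "\<lambda>z. G z + cnj (F z)"
  let ?\<Phi> = "\<lambda>t. deriv G (\<gamma> t) * vector_derivative \<gamma> (at t) + cnj (deriv F (\<gamma> t) * vector_derivative \<gamma> (at t))"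
  let ?I = "\<integral>\<^sup>+ t \<in> {0..<1}. ennreal (flat_length F G (\<gamma> t) (vector_derivative \<gamma> (at t))) \<partial>lborel"
  assume \<gamma>: "(\<forall>s. 0 < s \<and> s < 1 \<longrightarrow> \<gamma> piecewise_C1_differentiable_on {0..s}) \<and>
        \<gamma> ` {0..<1} \<subseteq> punctured_disc \<delta> \<and> 0 islimpt \<gamma> ` {0..<1}"
  then have img: "\<gamma> t \<in> punctured_disc \<delta>" if "0 \<le> t" "t < 1" for t
    using that by (auto simp del: punctured_disc_iff)
  have bound: "ennreal (cmod (?X (\<gamma> t) - ?X (\<gamma> 0))) \<le> ?I" if t: "0 < t" "t < 1" for t
  proof -
    obtain S where contg: "continuous_on {0..t} \<gamma>" and S: "finite S" "\<gamma> C1_differentiable_on ({0..t} - S)"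
      using \<gamma> t unfolding piecewise_C1_differentiable_on_def by blast
    \<comment> \<open>\<open>T\<close> omits the finitely many corners; the integrand is cut off to
      \<open>T\<close>, where it is continuous, so that it is Borel measurable on the whole
      line.\<close>
    define T where "T = {0..t} - S"
    have gT: "\<gamma> differentiable at x" if "x \<in> T" for x
      using S(2) that unfolding C1_differentiable_on_eq T_def by blast
    have cT: "continuous_on T (\<lambda>x. vector_derivative \<gamma> (at x))"
      using S(2) unfolding C1_differentiable_on_eq T_def by blast
    have TT: "T \<in> sets borel" unfolding T_def using S(1)
      by (intro sets.Diff) (auto intro: borel_closed finite_imp_closed)
    have cd: "continuous_on T (\<lambda>x. deriv G (\<gamma> x))" "continuous_on T (\<lambda>x. deriv F (\<gamma> x))"
      using holG holF img t continuous_on_subset[OF contg, of T] open_punctured_disc[of \<delta>]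
      by (auto simp: T_def simp del: punctured_disc_iff intro!: continuous_on_compose2[of "punctured_disc \<delta>" _ _ \<gamma>]
          holomorphic_on_imp_continuous_on holomorphic_deriv)
    have c\<Phi>: "continuous_on T ?\<Phi>"
      by (intro continuous_intros cd cT)
    have meas: "(\<lambda>x. indicator T x *\<^sub>R ?\<Phi> x) \<in> borel_measurable borel"
      by (rule borel_measurable_continuous_on_indicator[OF TT c\<Phi>])
    have X': "((\<lambda>x. ?X (\<gamma> x)) has_vector_derivative ?\<Phi> x) (at x)" if x: "x \<in> T" for x
    proof -
      have xx: "\<gamma> x \<in> punctured_disc \<delta>" using x t img by (auto simp: T_def simp del: punctured_disc_iff)
      have v: "(\<gamma> has_vector_derivative vector_derivative \<gamma> (at x)) (at x)"
        using gT[OF x] vector_derivative_works by blast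
      have "((\<lambda>x. G (\<gamma> x)) has_vector_derivative vector_derivative \<gamma> (at x) * deriv G (\<gamma> x)) (at x)"
        using field_vector_diff_chain_at[OF v holomorphic_derivI[OF holG open_punctured_disc xx]]
        by (simp add: o_def)
      moreover have "((\<lambda>x. F (\<gamma> x)) has_vector_derivative vector_derivative \<gamma> (at x) * deriv F (\<gamma> x)) (at x)"
        using field_vector_diff_chain_at[OF v holomorphic_derivI[OF holF open_punctured_disc xx]]
        by (simp add: o_def)
      ultimately show ?thesis
        by (auto intro!: derivative_eq_intros has_vector_derivative_cnj simp: mult.commute)
    qed
    have "continuous_on {0..t} (\<lambda>x. ?X (\<gamma> x))"
    proof -
      have "continuous_on (punctured_disc \<delta>) ?X"
        using holF holG by (intro continuous_intros holomorphic_on_imp_continuous_on)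
      then show ?thesis
        using contg img t by (auto simp del: punctured_disc_iff intro: continuous_on_compose2)
    qed
    then have "(?\<Phi> has_integral (?X (\<gamma> t) - ?X (\<gamma> 0))) {0..t}"
      using S(1) X' t
      by (intro fundamental_theorem_of_calculus_strong[of S]) (auto simp: T_def)
    then have "((\<lambda>x. indicator T x *\<^sub>R ?\<Phi> x) has_integral (?X (\<gamma> t) - ?X (\<gamma> 0))) {0..t}"
      using S(1) by (elim has_integral_spike_finite[rotated 2]) (auto simp: T_def)
    then have hk: "((\<lambda>x. indicator T x *\<^sub>R ?\<Phi> x) has_integral (?X (\<gamma> t) - ?X (\<gamma> 0))) UNIV"
      by (rule has_integral_on_superset) (auto simp: T_def)
    have le: "(\<integral>\<^sup>+ x. ennreal (norm (indicator T x *\<^sub>R ?\<Phi> x)) \<partial>lborel) \<le> ?I"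
      using t by (intro nn_integral_mono) (simp add: indicator_def flat_length_eq T_def)
    show ?thesis
    \<comment> \<open>If the norm has infinite integral, then so has the speed. Otherwise the
      integrand is Lebesgue integrable, and its integral is the displacement given by the
      fundamental theorem.\<close>
    proof (cases "(\<integral>\<^sup>+ x. ennreal (norm (indicator T x *\<^sub>R ?\<Phi> x)) \<partial>lborel) = \<infinity>")
      case True
      then show ?thesis using le by (simp add: top_unique)
    next
      case False
      then have int: "integrable lborel (\<lambda>x. indicator T x *\<^sub>R ?\<Phi> x)"
        using meas by (intro integrableI_bounded) (auto simp: less_top)
      have "?X (\<gamma> t) - ?X (\<gamma> 0) = integral\<^sup>L lborel (\<lambda>x. indicator T x *\<^sub>R ?\<Phi> x)"
        using has_integral_unique[OF hk has_integral_integral_lborel[OF int]] .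
      then have "ennreal (cmod (?X (\<gamma> t) - ?X (\<gamma> 0))) \<le> (\<integral>\<^sup>+ x. ennreal (norm (indicator T x *\<^sub>R ?\<Phi> x)) \<partial>lborel)"
        using integral_norm_bound_ennreal[OF int] by (simp only:)
      then show ?thesis using le by (rule order_trans)
    qed
  qed
  show "?I = \<infinity>"
  proof (rule ccontr)
    assume "?I \<noteq> \<infinity>"
    then obtain M where M: "?I = ennreal M" "M \<ge> 0" by (cases ?I) auto
    have "eventually (\<lambda>z. cmod (?X z) > cmod (?X (\<gamma> 0)) + M) (at 0)"
      using lim by (simp add: filterlim_at_top_dense)
    then obtain d where d: "d > 0" "\<And>z. z \<noteq> 0 \<Longrightarrow> cmod z < d \<Longrightarrow> cmod (?X z) > cmod (?X (\<gamma> 0)) + M"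
      unfolding eventually_at by (auto simp: dist_norm)
    obtain t where t: "0 \<le> t" "t < 1" "\<gamma> t \<noteq> 0" "cmod (\<gamma> t) < d"
    proof -
      have "\<exists>x'\<in>\<gamma> ` {0..<1}. x' \<noteq> 0 \<and> dist x' 0 < d"
        using \<gamma> d(1) unfolding islimpt_approachable by blast
      then show ?thesis using that by (auto simp: dist_norm)
    qed
    have big: "cmod (?X (\<gamma> t)) > cmod (?X (\<gamma> 0)) + M" using d t by blast
    then have "t \<noteq> 0" using M(2) by auto
    then have "ennreal (cmod (?X (\<gamma> t) - ?X (\<gamma> 0))) \<le> ennreal M"
      using bound[of t] t M by simp
    then have "cmod (?X (\<gamma> t) - ?X (\<gamma> 0)) \<le> M" using M by simp
    moreover have "cmod (?X (\<gamma> t)) - cmod (?X (\<gamma> 0)) \<le> cmod (?X (\<gamma> t) - ?X (\<gamma> 0))"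
      by (rule norm_triangle_ineq2)
    ultimately show False using big by linarith
  qed
qed

section \<open>Pole orders: the normal form of an end and the growth of injective functions\<close>

lemma deriv_over_power:
  assumes "f holomorphic_on ball 0 \<epsilon>" "\<And>w. w \<in> punctured_disc \<epsilon> \<Longrightarrow> F w = f w / w ^ n"
    and z: "z \<in> punctured_disc \<epsilon>"
  shows "deriv F z = (z * deriv f z - of_nat n * f z) / z ^ Suc n"
proof -
  have z0: "z \<noteq> 0" using z by simp
  have "(f has_field_derivative deriv f z) (at z)"
    using assms by (intro holomorphic_derivI[of _ "ball 0 \<epsilon>"]) auto
  then have "((\<lambda>w. f w / w ^ n) has_field_derivative
      (deriv f z * z ^ n - f z * (of_nat n * z ^ (n - 1))) / (z ^ n * z ^ n)) (at z)"
    using z0 by (auto intro!: derivative_eq_intros)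
  moreover have "(deriv f z * z ^ n - f z * (of_nat n * z ^ (n - 1))) / (z ^ n * z ^ n)
      = (z * deriv f z - of_nat n * f z) / z ^ Suc n"
    using z0 by (cases n) (auto simp: field_simps)
  ultimately have "((\<lambda>w. f w / w ^ n) has_field_derivative
      (z * deriv f z - of_nat n * f z) / z ^ Suc n) (at z)" by simp
  then have "(F has_field_derivative (z * deriv f z - of_nat n * f z) / z ^ Suc n) (at z)"
    by (rule has_field_derivative_transform_within_open[OF _ open_punctured_disc z]) (simp add: assms(2))
  then show ?thesis by (rule DERIV_imp_deriv)
qed

text \<open>The difference quotient defines \<open>k\<close> on the whole plane, so the
  factorization is available for every \<open>z\<close>, not only in the disc.\<close>

lemma holomorphic_divide_zero:
  assumes "f holomorphic_on ball 0 \<epsilon>" "\<epsilon> > 0" "f 0 = 0"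
  obtains k where "k holomorphic_on ball 0 \<epsilon>" "\<And>z. f z = z * k z" "k 0 = deriv f 0"
proof -
  let ?k = "\<lambda>z. if z = 0 then deriv f 0 else (f z - f 0) / (z - 0)"
  have "?k holomorphic_on ball 0 \<epsilon>"
    by (rule pole_lemma_open[OF assms(1) open_ball])
  then show ?thesis using that[of ?k] assms(3) by auto
qed

text \<open>\<open>n\<close> is the least exponent that clears the poles of both functions:
  minimality prevents \<open>f(0)\<close> and \<open>g(0)\<close> from both being zero, and
  completeness excludes \<open>n = 0\<close>. The inequality at 0 comes from the derivatives, whose
  numerators have the values \<open>- n f(0)\<close> and \<open>- n g(0)\<close> there.\<close>

lemma end_normal_form:
  assumes \<epsilon>: "\<epsilon> > 0" and holF: "F holomorphic_on punctured_disc \<epsilon>" and holG: "G holomorphic_on punctured_disc \<epsilon>"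
    and mer: "F meromorphic_on {0}" "G meromorphic_on {0}"
    and lt: "\<And>z. z \<in> punctured_disc \<epsilon> \<Longrightarrow> cmod (deriv G z) < cmod (deriv F z)"
    and complete: "complete_at_0 \<epsilon> F G"
  obtains n f g where "n \<ge> 1" "f holomorphic_on ball 0 \<epsilon>" "g holomorphic_on ball 0 \<epsilon>"
    "\<And>z. z \<in> punctured_disc \<epsilon> \<Longrightarrow> F z = f z / z ^ n" "\<And>z. z \<in> punctured_disc \<epsilon> \<Longrightarrow> G z = g z / z ^ n"
    "cmod (g 0) < cmod (f 0)"
proof -
  define P where "P k \<longleftrightarrow> (\<exists>f g. f holomorphic_on ball 0 \<epsilon> \<and> g holomorphic_on ball 0 \<epsilon> \<and>
     (\<forall>z\<in>punctured_disc \<epsilon>. F z = f z / z ^ k \<and> G z = g z / z ^ k))" for k :: nat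
  obtain kF kG where
    "\<And>k. k \<ge> kF \<Longrightarrow> \<exists>f. f holomorphic_on ball 0 \<epsilon> \<and> (\<forall>z\<in>punctured_disc \<epsilon>. F z = f z / z ^ k)"
    "\<And>k. k \<ge> kG \<Longrightarrow> \<exists>f. f holomorphic_on ball 0 \<epsilon> \<and> (\<forall>z\<in>punctured_disc \<epsilon>. G z = f z / z ^ k)"
    using meromorphic_at_0_factor[OF mer(1) holF \<epsilon>] meromorphic_at_0_factor[OF mer(2) holG \<epsilon>] by metis
  then have "P (max kF kG)" unfolding P_def by (meson max.cobounded1 max.cobounded2)
  define n where "n = (LEAST k. P k)"
  have "P n" unfolding n_def by (rule LeastI) fact
  have least: "\<not> P k" if "k < n" for k using that not_less_Least unfolding n_def by blast
  obtain f g where f: "f holomorphic_on ball 0 \<epsilon>" and g: "g holomorphic_on ball 0 \<epsilon>"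
    and F: "\<And>z. z \<in> punctured_disc \<epsilon> \<Longrightarrow> F z = f z / z ^ n"
    and G: "\<And>z. z \<in> punctured_disc \<epsilon> \<Longrightarrow> G z = g z / z ^ n"
    using \<open>P n\<close> unfolding P_def by blast
  have "n \<noteq> 0"
  proof
    assume "n = 0"
    then show False using not_complete_at_0[OF f g \<epsilon>, of F G] F G complete by auto
  qed
  then obtain j where j: "n = Suc j" by (cases n) auto
  have nz: "f 0 \<noteq> 0 \<or> g 0 \<noteq> 0"
  proof (rule ccontr)
    assume "\<not> (f 0 \<noteq> 0 \<or> g 0 \<noteq> 0)"
    then obtain f' g' where "f' holomorphic_on ball 0 \<epsilon>" "g' holomorphic_on ball 0 \<epsilon>"
        "\<And>z. f z = z * f' z" "\<And>z. g z = z * g' z"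
      using holomorphic_divide_zero[OF f \<epsilon>] holomorphic_divide_zero[OF g \<epsilon>] by metis
    then have "P j" unfolding P_def
      by (intro exI[of _ f'] exI[of _ g']) (auto simp: F G j)
    then show False using least j by blast
  qed
  \<comment> \<open>\<open>F' = A / z^(n+1)\<close> and \<open>G' = B / z^(n+1)\<close>; in contrast
    to the derivatives, \<open>A\<close> and \<open>B\<close> are holomorphic at 0.\<close>
  define A where "A z = z * deriv f z - of_nat n * f z" for z
  define B where "B z = z * deriv g z - of_nat n * g z" for z
  have holA: "A holomorphic_on ball 0 \<epsilon>" and holB: "B holomorphic_on ball 0 \<epsilon>"
    unfolding A_def B_def using f g by (auto intro!: holomorphic_intros)
  have AB: "cmod (B z) < cmod (A z)" if z: "z \<in> punctured_disc \<epsilon>" for z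
  proof -
    have "deriv F z = A z / z ^ Suc n" "deriv G z = B z / z ^ Suc n"
      unfolding A_def B_def using deriv_over_power[OF f F z] deriv_over_power[OF g G z] by blast+
    then have "cmod (B z) / cmod (z ^ Suc n) < cmod (A z) / cmod (z ^ Suc n)"
      using lt[OF z] by (simp only: norm_divide)
    then show ?thesis using z by (simp add: divide_less_cancel del: power_Suc)
  qed
  have "isCont A 0" "isCont B 0"
    using holA holB \<epsilon> by (auto intro!: continuous_on_interior[of "ball 0 \<epsilon>"] holomorphic_on_imp_continuous_on)
  then have lim: "((\<lambda>z. cmod (A z)) \<longlongrightarrow> cmod (A 0)) (at 0)" "((\<lambda>z. cmod (B z)) \<longlongrightarrow> cmod (B 0)) (at 0)"
    by (auto simp: isCont_def intro!: tendsto_norm)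
  have le: "cmod (B 0) \<le> cmod (A 0)"
  proof (rule tendsto_le[OF _ lim])
    show "eventually (\<lambda>z. cmod (B z) \<le> cmod (A z)) (at 0)"
      using AB \<epsilon> unfolding eventually_at by (auto simp: dist_norm intro!: exI[of _ \<epsilon>] less_imp_le)
  qed simp
  then have "f 0 \<noteq> 0" using nz \<open>n \<noteq> 0\<close> by (auto simp: A_def B_def)
  have A0: "A 0 \<noteq> 0" using \<open>f 0 \<noteq> 0\<close> \<open>n \<noteq> 0\<close> by (auto simp: A_def)
  have Anz: "A z \<noteq> 0" if "z \<in> ball 0 \<epsilon>" for z
    using AB[of z] A0 that by (cases "z = 0") auto
  \<comment> \<open>In the limit only \<open>\<le>\<close> survives. Equality at 0 would let |B / A|
    reach its maximum 1 at the centre, so \<open>B / A\<close> would be constant of modulus 1,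
    against the strict inequality off 0.\<close>
  have "cmod (B 0) \<noteq> cmod (A 0)"
  proof
    assume eq: "cmod (B 0) = cmod (A 0)"
    have "(\<lambda>z. B z / A z) constant_on ball 0 \<epsilon>"
    proof (rule maximum_modulus_principle[of _ _ "ball 0 \<epsilon>" 0])
      show "(\<lambda>z. B z / A z) holomorphic_on ball 0 \<epsilon>"
        using holA holB Anz by (intro holomorphic_intros) auto
      fix z :: complex assume z: "z \<in> ball 0 \<epsilon>"
      have "cmod (B z) \<le> cmod (A z)" using AB[of z] eq z by (cases "z = 0") auto
      then show "cmod (B z / A z) \<le> cmod (B 0 / A 0)"
        using eq A0 Anz[OF z] by (simp add: norm_divide)
    qed (use \<epsilon> in auto)
    then obtain c where c: "\<And>z. z \<in> ball 0 \<epsilon> \<Longrightarrow> B z / A z = c"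
      unfolding constant_on_def by blast
    have z: "of_real (\<epsilon>/2) \<in> punctured_disc \<epsilon>" using \<epsilon> by simp
    have "B 0 / A 0 = B (of_real (\<epsilon>/2)) / A (of_real (\<epsilon>/2))"
      using c[of 0] c[of "of_real (\<epsilon>/2)"] \<epsilon> z by auto
    then have "1 = cmod (B (of_real (\<epsilon>/2))) / cmod (A (of_real (\<epsilon>/2)))"
      using eq A0 by (metis norm_divide divide_self norm_eq_zero)
    then show False using AB[OF z] by auto
  qed
  then have "cmod (g 0) < cmod (f 0)" using le \<open>n \<noteq> 0\<close>
    by (auto simp: A_def B_def norm_mult)
  then show ?thesis
    using that[of n f g] f g F G \<open>n \<noteq> 0\<close> by auto
qed

text \<open>Behind this is the fact that an injective holomorphic function has at most a simple pole
  at an isolated singularity.\<close>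

lemma injective_at_0_bound:
  assumes hol: "\<phi> holomorphic_on punctured_disc \<delta>" and inj: "inj_on \<phi> (punctured_disc \<delta>)" and \<delta>: "\<delta> > 0"
  obtains C where "eventually (\<lambda>z. cmod (\<phi> z) * cmod z \<le> C) (at 0)"
proof -
  have ev: "eventually (\<lambda>z. z \<in> punctured_disc \<delta>) (at 0)"
    unfolding eventually_at using \<delta> by (auto simp: dist_norm)
  have "\<exists>l. (\<phi> \<longlongrightarrow> l) (at 0) \<or> ((inverse \<circ> \<phi>) \<longlongrightarrow> l) (at 0)"
  proof (rule ccontr)
    assume "\<nexists>l. (\<phi> \<longlongrightarrow> l) (at 0) \<or> ((inverse \<circ> \<phi>) \<longlongrightarrow> l) (at 0)"
    moreover have sub: "punctured_disc (\<delta>/2) \<subseteq> punctured_disc \<delta>"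
      using \<delta> by (intro punctured_disc_mono) simp
    ultimately have dense: "closure (\<phi> ` (ball 0 (\<delta>/2) - {0})) = UNIV"
      using \<delta> hol holomorphic_on_subset by (intro Casorati_Weierstrass) (auto simp: punctured_disc_def)
    \<comment> \<open>\<open>V\<close> is the outer annulus. Its image is open, hence meets the
      dense image of the inner punctured disc, which injectivity forbids.\<close>
    define V where "V = ball 0 \<delta> - cball (0::complex) (\<delta>/2)"
    have V: "open V" "V \<subseteq> punctured_disc \<delta>" using \<delta> by (auto simp: V_def)
    have "of_real (3/4 * \<delta>) \<in> V" unfolding V_def mem_ball mem_cball Diff_iff dist_0_norm norm_of_real using \<delta> by auto
    then have "V \<noteq> {}" by auto
    have "open (\<phi> ` V)"
      using open_mapping_thm3[of \<phi> V] hol inj V holomorphic_on_subset inj_on_subset by metis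
    moreover have "\<phi> ` V \<inter> \<phi> ` (ball 0 (\<delta>/2) - {0}) = {}"
      using inj sub V by (fastforce simp: inj_on_def V_def punctured_disc_def)
    ultimately have "\<phi> ` V \<inter> closure (\<phi> ` (ball 0 (\<delta>/2) - {0})) = {}"
      by (simp add: open_Int_closure_eq_empty)
    then show False using dense \<open>V \<noteq> {}\<close> by auto
  qed
  then obtain l where "(\<phi> \<longlongrightarrow> l) (at 0) \<or> ((inverse \<circ> \<phi>) \<longlongrightarrow> l) (at 0)" by blast
  then show ?thesis
  proof
    assume "(\<phi> \<longlongrightarrow> l) (at 0)"
    then have "((\<lambda>z. cmod (\<phi> z) * cmod z) \<longlongrightarrow> cmod l * cmod 0) (at 0)"
      by (intro tendsto_intros)
    then have "eventually (\<lambda>z. cmod (\<phi> z) * cmod z < 1) (at 0)"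
      by (intro order_tendstoD) auto
    then show ?thesis by (intro that[of 1]) (auto elim: eventually_mono)
  next
    assume l: "((inverse \<circ> \<phi>) \<longlongrightarrow> l) (at 0)"
    show ?thesis
    proof (cases "l = 0")
      case False
      then have "(\<lambda>z. inverse ((inverse \<circ> \<phi>) z)) \<midarrow>0\<rightarrow> inverse l" using l by (intro tendsto_intros)
      then have "((\<lambda>z. cmod (\<phi> z) * cmod z) \<longlongrightarrow> cmod (inverse l) * cmod 0) (at 0)"
        by (intro tendsto_intros) (simp add: o_def)
      then have "eventually (\<lambda>z. cmod (\<phi> z) * cmod z < 1) (at 0)"
        by (intro order_tendstoD) auto
      then show ?thesis by (intro that[of 1]) (auto elim: eventually_mono)
    next
      case True
      define h where "h z = (if z = 0 then 0 else inverse (\<phi> z))" for z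
      \<comment> \<open>By injectivity there is at most one zero of \<open>\<phi>\<close>; if it
        exists, its modulus serves as radius.\<close>
      obtain r where r: "0 < r" "r \<le> \<delta>" and nz: "\<And>z. z \<in> punctured_disc r \<Longrightarrow> \<phi> z \<noteq> 0"
      proof (cases "\<exists>z\<in>punctured_disc \<delta>. \<phi> z = 0")
        case True
        then obtain z where z: "z \<in> punctured_disc \<delta>" "\<phi> z = 0" by blast
        show ?thesis
        proof (rule that[of "cmod z"])
          fix w assume w: "w \<in> punctured_disc (cmod z)"
          then have "w \<noteq> z" "w \<in> punctured_disc \<delta>" using z by auto
          then show "\<phi> w \<noteq> 0" using inj z unfolding inj_on_def by metis
        qed (use z in auto)
      qed (use that[of \<delta>] \<delta> in auto)
      have holh: "h holomorphic_on ball 0 r"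
        unfolding h_def
      proof (rule removable_singularity)
        show "(\<lambda>z. inverse (\<phi> z)) holomorphic_on ball 0 r - {0}"
          using nz holomorphic_on_subset[OF hol punctured_disc_mono[OF r(2)]]
          unfolding punctured_disc_def[symmetric] by (intro holomorphic_intros) auto
        show "(\<lambda>z. inverse (\<phi> z)) \<midarrow>0\<rightarrow> 0" using l True by (simp add: o_def)
      qed simp
      have "inj_on h (ball 0 r)"
      proof (rule inj_onI)
        fix x y assume xy: "x \<in> ball 0 r" "y \<in> ball 0 r" and eq: "h x = h y"
        have iff: "h w = 0 \<longleftrightarrow> w = 0" if "w \<in> ball 0 r" for w
          using nz[of w] that by (auto simp: h_def)
        show "x = y"
        proof (cases "x = 0")
          case True
          then show ?thesis using iff xy eq by metis
        next
          case False
          then have "y \<noteq> 0" using iff xy eq by metis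
          with False eq have "\<phi> x = \<phi> y" by (simp add: h_def)
          then show ?thesis
            using inj_onD[OF inj] False \<open>y \<noteq> 0\<close> xy r by simp
        qed
      qed
      \<comment> \<open>\<open>h\<close> extends \<open>1 / \<phi>\<close> by 0 and stays injective,
        so its zero is simple and \<open>\<phi>\<close> grows like 1/z.\<close>
      then have "deriv h 0 \<noteq> 0"
        using holomorphic_injective_imp_regular[OF holh] r by simp
      have "(h has_field_derivative deriv h 0) (at 0)"
        using holh r by (intro holomorphic_derivI[of _ "ball 0 r"]) auto
      then have "((\<lambda>z. h z / z) \<longlongrightarrow> deriv h 0) (at 0)"
        by (simp add: has_field_derivative_iff h_def)
      then have "((\<lambda>z. inverse (cmod (h z / z))) \<longlongrightarrow> inverse (cmod (deriv h 0))) (at 0)"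
        using \<open>deriv h 0 \<noteq> 0\<close> by (intro tendsto_intros) auto
      then have "eventually (\<lambda>z. inverse (cmod (h z / z)) < inverse (cmod (deriv h 0)) + 1) (at 0)"
        by (intro order_tendstoD) auto
      moreover have "inverse (cmod (h z / z)) = cmod (\<phi> z) * cmod z" if "z \<noteq> 0" for z
        using that by (simp add: h_def norm_divide norm_mult norm_inverse divide_simps)
      ultimately show ?thesis
        by (intro that[of "inverse (cmod (deriv h 0)) + 1"])
           (auto simp: eventually_at_filter elim!: eventually_mono)
    qed
  qed
qed

section \<open>Ends of higher multiplicity are not embedded\<close>

text \<open>A universal chord argument: over \<open>n\<close> steps of length \<open>c\<close> the
  differences \<open>D\<close> telescope to 0, so the continuous function \<open>D\<close> cannot
  keep a strict sign.\<close>

lemma periodic_chord: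
  fixes \<tau> :: "real \<Rightarrow> real"
  assumes cont: "continuous_on UNIV \<tau>" and per: "\<tau> (of_nat n * c) = \<tau> 0" and n: "n \<ge> 1"
  obtains \<theta> where "\<tau> (\<theta> + c) = \<tau> \<theta>"
proof (rule ccontr)
  assume "\<not> thesis"
  then have nz: "\<tau> (\<theta> + c) - \<tau> \<theta> \<noteq> 0" for \<theta> using that by auto
  define D where "D \<theta> = \<tau> (\<theta> + c) - \<tau> \<theta>" for \<theta>
  have "continuous_on UNIV D"
    unfolding D_def by (intro continuous_intros continuous_on_compose2[OF cont]) auto
  then have "connected (range D)"
    by (rule connected_continuous_image) simp
  then have sgn: "\<not> (D x < 0 \<and> D y > 0)" for x y
    using connectedD_interval[of "range D" "D x" "D y" 0] nz by (auto simp: D_def)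
  have tel: "(\<Sum>k<m. D (of_nat k * c)) = \<tau> (of_nat m * c) - \<tau> 0" for m :: nat
    by (induction m) (auto simp: D_def algebra_simps)
  then have "(\<Sum>k<n. D (of_nat k * c)) = 0" using per by simp
  moreover have "(\<Sum>k<n. D (of_nat k * c)) \<noteq> 0"
  proof (cases "D 0 > 0")
    case True
    then have "D x > 0" for x using sgn[of x 0] nz[of x] by (auto simp: D_def not_less_iff_gr_or_eq)
    then have "(\<Sum>k<n. D (of_nat k * c)) > 0" using n by (intro sum_pos) (auto simp: lessThan_empty_iff)
    then show ?thesis by simp
  next
    case False
    then have "D x < 0" for x using sgn[of 0 x] nz[of x] nz[of 0] by (auto simp: D_def not_less_iff_gr_or_eq)
    then have "(\<Sum>k<n. - D (of_nat k * c)) > 0" using n by (intro sum_pos) (auto simp: lessThan_empty_iff)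
    then show ?thesis by (simp add: sum_negf)
  qed
  ultimately show False by blast
qed

text \<open>
  The end is uniformized by \<open>z = exp (- s)\<close> on half-planes, which, unlike punctured discs, are convex.
\<close>

definition small_lipschitz :: "(complex \<Rightarrow> complex) \<Rightarrow> bool" where
  "small_lipschitz Q \<longleftrightarrow> (\<forall>\<kappa>>0. \<exists>A. \<forall>s s'. A \<le> Re s \<longrightarrow> A \<le> Re s' \<longrightarrow>
     cmod (Q s) \<le> \<kappa> \<and> cmod (Q s - Q s') \<le> \<kappa> * cmod (s - s'))"

lemma small_lipschitzE:
  assumes "small_lipschitz Q" "\<kappa> > 0"
  obtains A where "\<And>s. A \<le> Re s \<Longrightarrow> cmod (Q s) \<le> \<kappa>"
    "\<And>s s'. A \<le> Re s \<Longrightarrow> A \<le> Re s' \<Longrightarrow> cmod (Q s - Q s') \<le> \<kappa> * cmod (s - s')"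
proof -
  obtain A where "\<forall>s s'. A \<le> Re s \<longrightarrow> A \<le> Re s' \<longrightarrow>
     cmod (Q s) \<le> \<kappa> \<and> cmod (Q s - Q s') \<le> \<kappa> * cmod (s - s')"
    using assms unfolding small_lipschitz_def by blast
  then show ?thesis using that[of A] by blast
qed

section \<open>Calculus of small Lipschitz functions on half-planes\<close>

lemma small_lipschitz_add:
  assumes "small_lipschitz P" "small_lipschitz Q"
  shows "small_lipschitz (\<lambda>s. P s + Q s)"
  unfolding small_lipschitz_def
proof (intro allI impI)
  fix \<kappa> :: real assume "\<kappa> > 0"
  then have k2: "\<kappa> / 2 > 0" by simp
  obtain A where A: "\<And>s. A \<le> Re s \<Longrightarrow> cmod (P s) \<le> \<kappa> / 2"
    "\<And>s s'. A \<le> Re s \<Longrightarrow> A \<le> Re s' \<Longrightarrow> cmod (P s - P s') \<le> \<kappa> / 2 * cmod (s - s')"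
    using small_lipschitzE[OF assms(1) k2] by blast
  obtain B where B: "\<And>s. B \<le> Re s \<Longrightarrow> cmod (Q s) \<le> \<kappa> / 2"
    "\<And>s s'. B \<le> Re s \<Longrightarrow> B \<le> Re s' \<Longrightarrow> cmod (Q s - Q s') \<le> \<kappa> / 2 * cmod (s - s')"
    using small_lipschitzE[OF assms(2) k2] by blast
  show "\<exists>A. \<forall>s s'. A \<le> Re s \<longrightarrow> A \<le> Re s' \<longrightarrow> cmod (P s + Q s) \<le> \<kappa> \<and>
      cmod (P s + Q s - (P s' + Q s')) \<le> \<kappa> * cmod (s - s')"
  proof (intro exI[of _ "max A B"] allI impI conjI)
    fix s s' assume s: "max A B \<le> Re s" "max A B \<le> Re s'"
    show "cmod (P s + Q s) \<le> \<kappa>"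
      using norm_triangle_ineq[of "P s" "Q s"] A(1)[of s] B(1)[of s] s by simp
    show "cmod (P s + Q s - (P s' + Q s')) \<le> \<kappa> * cmod (s - s')"
      using norm_diff_triangle_ineq[of "P s" "Q s" "P s'" "Q s'"] A(2)[of s s'] B(2)[of s s'] s by simp
  qed
qed

text \<open>Meant for the factor \<open>(z / cnj z) ^ n\<close>, which has no limit at the puncture
  but is bounded and Lipschitz in the variable \<open>s\<close>. Differences are split as in the
  product rule.\<close>

lemma small_lipschitz_mult:
  assumes "\<And>s. cmod (W s) \<le> K" "\<And>s s'. cmod (W s - W s') \<le> K * cmod (s - s')" "small_lipschitz Q"
  shows "small_lipschitz (\<lambda>s. W s * Q s)"
  unfolding small_lipschitz_def
proof (intro allI impI)
  fix \<kappa> :: real assume \<kappa>: "\<kappa> > 0"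
  have K: "K \<ge> 0" using assms(1)[of 0] norm_ge_zero order_trans by blast
  \<comment> \<open>The product estimate yields the factor \<open>2 K \<mu>\<close>; the summand 1
    avoids division by 0 when \<open>K = 0\<close>.\<close>
  define \<mu> where "\<mu> = \<kappa> / (2 * (K + 1))"
  have \<mu>: "\<mu> > 0" "2 * (K * \<mu>) \<le> \<kappa>"
    using \<kappa> K by (auto simp: \<mu>_def field_simps)
  obtain A where A: "\<And>s. A \<le> Re s \<Longrightarrow> cmod (Q s) \<le> \<mu>"
    "\<And>s s'. A \<le> Re s \<Longrightarrow> A \<le> Re s' \<Longrightarrow> cmod (Q s - Q s') \<le> \<mu> * cmod (s - s')"
    using small_lipschitzE[OF assms(3) \<mu>(1)] by blast
  show "\<exists>A. \<forall>s s'. A \<le> Re s \<longrightarrow> A \<le> Re s' \<longrightarrow> cmod (W s * Q s) \<le> \<kappa> \<and>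
      cmod (W s * Q s - W s' * Q s') \<le> \<kappa> * cmod (s - s')"
  proof (intro exI[of _ A] allI impI conjI)
    fix s s' assume s: "A \<le> Re s" "A \<le> Re s'"
    have "cmod (W s * Q s) \<le> K * \<mu>"
      unfolding norm_mult using assms(1) A(1)[OF s(1)] K by (intro mult_mono) auto
    moreover have "0 \<le> K * \<mu>" using K \<mu> by simp
    ultimately show "cmod (W s * Q s) \<le> \<kappa>" using \<mu>(2) by linarith
    have "W s * Q s - W s' * Q s' = W s * (Q s - Q s') + (W s - W s') * Q s'"
      by (simp add: algebra_simps)
    also have "cmod \<dots> \<le> cmod (W s) * cmod (Q s - Q s') + cmod (W s - W s') * cmod (Q s')"
      by (metis norm_mult norm_triangle_ineq)
    also have "\<dots> \<le> K * (\<mu> * cmod (s - s')) + (K * cmod (s - s')) * \<mu>"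
      using assms(1,2) A(1)[OF s(2)] A(2)[OF s] K by (intro add_mono mult_mono) auto
    also have "\<dots> = 2 * (K * \<mu>) * cmod (s - s')" by simp
    also have "\<dots> \<le> \<kappa> * cmod (s - s')" using \<mu>(2) by (intro mult_right_mono) auto
    finally show "cmod (W s * Q s - W s' * Q s') \<le> \<kappa> * cmod (s - s')" .
  qed
qed

lemma small_lipschitz_cmult:
  assumes "small_lipschitz Q"
  shows "small_lipschitz (\<lambda>s. c * Q s)"
  by (rule small_lipschitz_mult[of "\<lambda>_. c" "cmod c"]) (use assms in auto)

lemma small_lipschitz_cnj:
  assumes "small_lipschitz Q"
  shows "small_lipschitz (\<lambda>s. cnj (Q s))"
  using assms unfolding small_lipschitz_def
  by (simp flip: complex_cnj_diff)

text \<open>On the disc of radius 1/2 the derivative \<open>1 / (1 + x)\<close> is bounded by 2, and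
  convexity turns this into a Lipschitz constant.\<close>

lemma small_lipschitz_Ln:
  assumes "small_lipschitz Q"
  shows "small_lipschitz (\<lambda>s. Ln (1 + Q s))"
proof -
  have Ln2: "cmod (Ln (1 + x) - Ln (1 + y)) \<le> 2 * cmod (x - y)"
    if "x \<in> cball 0 (1/2)" "y \<in> cball 0 (1/2)" for x y :: complex
  proof (rule field_differentiable_bound[of "cball 0 (1/2)" _ "\<lambda>x. 1 / (1 + x)"])
    fix z :: complex assume z: "z \<in> cball 0 (1/2)"
    then have r: "\<bar>Re z\<bar> \<le> 1/2" using abs_Re_le_cmod[of z] by simp
    then have "1 + z \<notin> \<real>\<^sub>\<le>\<^sub>0" by (auto simp: complex_nonpos_Reals_iff)
    then show "((\<lambda>x. Ln (1 + x)) has_field_derivative 1 / (1 + z)) (at z within cball 0 (1/2))"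
      by (auto intro!: derivative_eq_intros simp: field_simps)
    have "1/2 \<le> Re (1 + z)" using r by simp
    also have "\<dots> \<le> cmod (1 + z)" by (rule complex_Re_le_cmod)
    finally show "cmod (1 / (1 + z)) \<le> 2"
      by (simp add: norm_divide divide_le_eq)
  qed (use that in auto)
  show ?thesis
    unfolding small_lipschitz_def
  proof (intro allI impI)
    fix \<kappa> :: real assume \<kappa>: "\<kappa> > 0"
    define \<mu> where "\<mu> = min (\<kappa> / 2) (1/2)"
    have \<mu>: "\<mu> > 0" "2 * \<mu> \<le> \<kappa>" "\<mu> \<le> 1/2" using \<kappa> by (auto simp: \<mu>_def)
    obtain A where A: "\<And>s. A \<le> Re s \<Longrightarrow> cmod (Q s) \<le> \<mu>"
      "\<And>s s'. A \<le> Re s \<Longrightarrow> A \<le> Re s' \<Longrightarrow> cmod (Q s - Q s') \<le> \<mu> * cmod (s - s')"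
      using small_lipschitzE[OF assms \<mu>(1)] by blast
    show "\<exists>A. \<forall>s s'. A \<le> Re s \<longrightarrow> A \<le> Re s' \<longrightarrow> cmod (Ln (1 + Q s)) \<le> \<kappa> \<and>
        cmod (Ln (1 + Q s) - Ln (1 + Q s')) \<le> \<kappa> * cmod (s - s')"
    proof (intro exI[of _ A] allI impI conjI)
      fix s s' assume s: "A \<le> Re s" "A \<le> Re s'"
      have Q: "Q s \<in> cball 0 (1/2)" "Q s' \<in> cball 0 (1/2)"
        using A(1)[OF s(1)] A(1)[OF s(2)] \<mu>(3) by simp_all
      show "cmod (Ln (1 + Q s)) \<le> \<kappa>"
        using Ln2[OF Q(1), of 0] A(1)[OF s(1)] \<mu>(2) by simp
      have "cmod (Ln (1 + Q s) - Ln (1 + Q s')) \<le> 2 * (\<mu> * cmod (s - s'))"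
        using Ln2[OF Q] A(2)[OF s] by linarith
      also have "\<dots> \<le> \<kappa> * cmod (s - s')" using mult_right_mono[OF \<mu>(2), of "cmod (s - s')"] by simp
      finally show "cmod (Ln (1 + Q s) - Ln (1 + Q s')) \<le> \<kappa> * cmod (s - s')" .
    qed
  qed
qed

lemma holomorphic_lipschitz:
  assumes "m holomorphic_on ball 0 r" "0 \<le> \<rho>" "\<rho> < r"
  obtains M where "M > 0" "\<And>z. z \<in> cball 0 \<rho> \<Longrightarrow> cmod (deriv m z) \<le> M"
    "\<And>x y. x \<in> cball 0 \<rho> \<Longrightarrow> y \<in> cball 0 \<rho> \<Longrightarrow> cmod (m x - m y) \<le> M * cmod (x - y)"
proof -
  have sub: "cball 0 \<rho> \<subseteq> ball (0::complex) r" using assms by auto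
  have "deriv m holomorphic_on ball 0 r"
    using assms by (auto intro: holomorphic_deriv)
  then have "compact (deriv m ` cball 0 \<rho>)"
    using sub by (intro compact_continuous_image) (auto intro!: holomorphic_on_imp_continuous_on elim!: holomorphic_on_subset)
  then obtain M where M: "M > 0" "\<And>z. z \<in> cball 0 \<rho> \<Longrightarrow> cmod (deriv m z) \<le> M"
    using compact_imp_bounded[THEN bounded_pos[THEN iffD1]] by (metis imageI)
  have "cmod (m x - m y) \<le> M * cmod (x - y)" if xy: "x \<in> cball 0 \<rho>" "y \<in> cball 0 \<rho>" for x y
  proof (rule field_differentiable_bound[of "cball 0 \<rho>" m "deriv m"])
    fix z :: complex assume "z \<in> cball 0 \<rho>"
    then show "(m has_field_derivative deriv m z) (at z within cball 0 \<rho>)"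
      using holomorphic_derivI[OF assms(1) open_ball] sub has_field_derivative_at_within by blast
  qed (use M xy in auto)
  then show ?thesis using that M by blast
qed

text \<open>The derivative with respect to \<open>s\<close> carries the factor
  \<open>exp (- s)\<close>, which is small far to the right; on a convex half-plane this bounds the
  differences. The values are small because of \<open>m 0 = 0\<close>.\<close>

lemma small_lipschitz_exp:
  assumes "m holomorphic_on ball 0 r" "r > 0" "m 0 = 0"
  shows "small_lipschitz (\<lambda>s. m (exp (- s)))"
  unfolding small_lipschitz_def
proof (intro allI impI)
  fix \<kappa> :: real assume \<kappa>: "\<kappa> > 0"
  obtain M where M: "M > 0" "\<And>z. z \<in> cball 0 (r/2) \<Longrightarrow> cmod (deriv m z) \<le> M"
    "\<And>x y. x \<in> cball 0 (r/2) \<Longrightarrow> y \<in> cball 0 (r/2) \<Longrightarrow> cmod (m x - m y) \<le> M * cmod (x - y)"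
    using holomorphic_lipschitz[OF assms(1), of "r/2"] assms(2) by auto
  \<comment> \<open>\<open>exp (- A)\<close> is the minimum of \<open>r/2\<close>, the radius up to
    which \<open>M\<close> bounds the derivative of \<open>m\<close>, and
    \<open>\<kappa> / M\<close>, which brings the derivative in \<open>s\<close> below
    \<open>\<kappa>\<close>.\<close>
  define A where "A = - ln (min (r/2) (\<kappa> / M))"
  have eA: "exp (- A) = min (r/2) (\<kappa> / M)" using assms(2) \<kappa> M(1) by (simp add: A_def)
  have small: "cmod (exp (- s)) \<le> min (r/2) (\<kappa> / M)" if "A \<le> Re s" for s
    unfolding eA[symmetric] using that by simp
  have inb: "exp (- s) \<in> cball 0 (r/2)" if "A \<le> Re s" for s
    using small[OF that] by simp
  have Mk: "M * cmod (exp (- s)) \<le> \<kappa>" if "A \<le> Re s" for s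
    using small[OF that] M(1) by (simp add: field_simps)
  show "\<exists>A. \<forall>s s'. A \<le> Re s \<longrightarrow> A \<le> Re s' \<longrightarrow> cmod (m (exp (- s))) \<le> \<kappa> \<and>
      cmod (m (exp (- s)) - m (exp (- s'))) \<le> \<kappa> * cmod (s - s')"
  proof (intro exI[of _ A] allI impI conjI)
    fix s s' assume s: "A \<le> Re s" "A \<le> Re s'"
    have "cmod (m (exp (- s))) \<le> M * cmod (exp (- s))"
      using M(3)[OF inb[OF s(1)], of 0] assms by simp
    also have "\<dots> \<le> \<kappa>" by (rule Mk[OF s(1)])
    finally show "cmod (m (exp (- s))) \<le> \<kappa>" .
    show "cmod (m (exp (- s)) - m (exp (- s'))) \<le> \<kappa> * cmod (s - s')"
    proof (rule field_differentiable_bound[of "{s. A \<le> Re s}" _ "\<lambda>s. deriv m (exp (- s)) * (- exp (- s))"])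
      show "convex {s. A \<le> Re s}" using convex_halfspace_Re_ge[of A] by simp
      fix z assume "z \<in> {s. A \<le> Re s}"
      then have z: "A \<le> Re z" by simp
      have "exp (- z) \<in> ball 0 r" using inb[OF z] assms(2) by (auto intro: le_less_trans)
      then have "(m has_field_derivative deriv m (exp (- z))) (at (exp (- z)))"
        using assms(1) by (intro holomorphic_derivI) auto
      then have "((\<lambda>s. m (exp (- s))) has_field_derivative deriv m (exp (- z)) * (- exp (- z))) (at z)"
        by (rule DERIV_chain2) (auto intro!: derivative_eq_intros)
      then show "((\<lambda>s. m (exp (- s))) has_field_derivative deriv m (exp (- z)) * (- exp (- z))) (at z within {s. A \<le> Re s})"
        by (rule has_field_derivative_at_within)
      have "cmod (deriv m (exp (- z)) * (- exp (- z))) \<le> M * cmod (exp (- z))"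
        unfolding norm_mult norm_minus_cancel using M(2)[OF inb[OF z]] by (intro mult_right_mono) auto
      then show "cmod (deriv m (exp (- z)) * (- exp (- z))) \<le> \<kappa>" using Mk[OF z] by linarith
    qed (use s in auto)
  qed
qed

lemma exp_lipschitz_imaginary: "cmod (exp (\<i> * of_real a) - exp (\<i> * of_real b)) \<le> \<bar>a - b\<bar>"
proof -
  have "exp (\<i> * of_real a) - exp (\<i> * of_real b) = exp (\<i> * of_real b) * (exp (\<i> * of_real (a - b)) - 1)"
    by (simp add: right_diff_distrib exp_add[symmetric] algebra_simps)
  then have "cmod (exp (\<i> * of_real a) - exp (\<i> * of_real b)) = 2 * \<bar>sin ((a - b) / 2)\<bar>"
    using dist_exp_i_1[of "a - b"] by (simp add: norm_mult)
  also have "\<dots> \<le> 2 * \<bar>(a - b) / 2\<bar>"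
    using abs_sin_x_le_abs_x[of "(a - b) / 2"] by (intro mult_left_mono) simp_all
  finally show ?thesis by simp
qed

text \<open>Existence is Banach's fixed point theorem for \<open>s \<mapsto> (y - E s) / n\<close>;
  uniqueness and continuity follow because \<open>n s + E s\<close> expands distances by at least
  the factor \<open>3/4\<close>. Uniqueness on the whole half-plane is what later closes the
  loop.\<close>

lemma inverse_near_linear:
  fixes E :: "complex \<Rightarrow> complex"
  assumes n: "n \<ge> (1::nat)"
    and E: "\<And>s. A \<le> Re s \<Longrightarrow> cmod (E s) \<le> 1/4"
    and lip: "\<And>s s'. A \<le> Re s \<Longrightarrow> A \<le> Re s' \<Longrightarrow> cmod (E s - E s') \<le> 1/4 * cmod (s - s')"
  obtains Y B where "\<And>y. B \<le> Re y \<Longrightarrow> A \<le> Re (Y y) \<and> of_nat n * Y y + E (Y y) = y"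
    "continuous_on {y. B \<le> Re y} Y"
    "\<And>y s. B \<le> Re y \<Longrightarrow> A \<le> Re s \<Longrightarrow> of_nat n * s + E s = y \<Longrightarrow> s = Y y"
proof -
  \<comment> \<open>For such \<open>y\<close> the real part of \<open>y / n\<close> is at least
    \<open>A + 1\<close>, so the disc of radius 1/4 about it stays in the half-plane where
    \<open>E\<close> is controlled.\<close>
  define B where "B = of_nat n * (A + 1)"
  have expand: "3/4 * cmod (s - s') \<le> cmod ((of_nat n * s + E s) - (of_nat n * s' + E s'))"
    if "A \<le> Re s" "A \<le> Re s'" for s s'
  proof -
    have "cmod (s - s') \<le> of_nat n * cmod (s - s')"
      using mult_right_mono[of 1 "of_nat n" "cmod (s - s')"] n by simp
    also have "\<dots> = cmod (of_nat n * (s - s'))" by (simp add: norm_mult)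
    also have "of_nat n * (s - s') = ((of_nat n * s + E s) - (of_nat n * s' + E s')) - (E s - E s')"
      by (simp add: algebra_simps)
    also have "cmod \<dots> \<le> cmod ((of_nat n * s + E s) - (of_nat n * s' + E s')) + cmod (E s - E s')"
      by (rule norm_triangle_ineq4)
    finally show ?thesis using lip[OF that] by simp
  qed
  have ex: "\<exists>s. A \<le> Re s \<and> of_nat n * s + E s = y" if y: "B \<le> Re y" for y
  proof -
    let ?S = "cball (y / of_nat n) (1/4)"
    let ?T = "\<lambda>s. (y - E s) / of_nat n"
    have Rey: "Re (y / of_nat n) \<ge> A + 1"
      using y n unfolding B_def by (simp add: field_simps)
    have S: "A \<le> Re s" if "s \<in> ?S" for s
    proof -
      have "\<bar>Re (y / of_nat n - s)\<bar> \<le> 1/4"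
        using that abs_Re_le_cmod[of "y / of_nat n - s"] unfolding mem_cball dist_norm by linarith
      then have "Re (y / of_nat n) - Re s \<le> 1/4" unfolding minus_complex.simps by (rule abs_le_D1)
      then show ?thesis using Rey by linarith
    qed
    have nn: "x / of_nat n \<le> x" if "x \<ge> 0" for x :: real
      using that n mult_left_mono[of 1 "of_nat n" x] by (simp add: divide_le_eq)
    have "\<exists>!s. s \<in> ?S \<and> ?T s = s"
    proof (rule Banach_fix[of ?S "1/4" ?T])
      show "?T ` ?S \<subseteq> ?S"
      proof
        fix w assume "w \<in> ?T ` ?S"
        then obtain s where s: "s \<in> ?S" "w = ?T s" by blast
        have "dist (y / of_nat n) w = cmod (E s) / of_nat n"
          unfolding s dist_norm by (simp add: diff_divide_distrib norm_divide)
        also have "\<dots> \<le> cmod (E s)" by (rule nn) simp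
        also have "\<dots> \<le> 1/4" by (rule E[OF S[OF s(1)]])
        finally show "w \<in> ?S" by simp
      qed
      fix s s' assume s: "s \<in> ?S" "s' \<in> ?S"
      have "dist (?T s) (?T s') = cmod ((E s' - E s) / of_nat n)"
        unfolding dist_norm by (simp add: diff_divide_distrib)
      also have "\<dots> \<le> cmod (E s' - E s)" using nn[of "cmod (E s' - E s)"] by (simp add: norm_divide)
      also have "\<dots> \<le> 1/4 * cmod (s' - s)" using lip[OF S[OF s(2)] S[OF s(1)]] .
      finally show "dist (?T s) (?T s') \<le> 1/4 * dist s s'" by (simp add: dist_norm norm_minus_commute)
    qed (auto simp: complete_eq_closed)
    then obtain s where s: "s \<in> ?S" "?T s = s" by blast
    then have "of_nat n * s + E s = y" using n by (simp add: field_simps)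
    then show ?thesis using S[OF s(1)] by blast
  qed
  define Y where "Y y = (SOME s. A \<le> Re s \<and> of_nat n * s + E s = y)" for y
  have Y: "A \<le> Re (Y y) \<and> of_nat n * Y y + E (Y y) = y" if "B \<le> Re y" for y
    unfolding Y_def by (rule someI_ex[OF ex[OF that]])
  have "continuous_on {y. B \<le> Re y} Y"
    unfolding continuous_on_iff
  proof (intro ballI allI impI)
    fix y and e :: real assume y: "y \<in> {y. B \<le> Re y}" and e: "e > 0"
    have "dist (Y y') (Y y) < e" if "y' \<in> {y. B \<le> Re y}" "dist y' y < 3/4 * e" for y'
      using expand[of "Y y'" "Y y"] Y[of y] Y[of y'] y that by (simp add: dist_norm)
    then show "\<exists>d>0. \<forall>x'\<in>{y. B \<le> Re y}. dist x' y < d \<longrightarrow> dist (Y x') (Y y) < e"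
      using e by (intro exI[of _ "3/4 * e"]) auto
  qed
  moreover have "s = Y y" if "B \<le> Re y" "A \<le> Re s" "of_nat n * s + E s = y" for y s
    using expand[of s "Y y"] Y[of y] that by simp
  ultimately show ?thesis using that[of B Y] Y by blast
qed

text \<open>
  With the real-linear map \<open>L y = cnj y + h0 y\<close>, \<open>h0 = g(0) / f(0)\<close>, one has
  \<open>x(exp (- s)) = L (f(0) exp (n s + E(s)))\<close> for some small Lipschitz function \<open>E\<close>.  The loop is
  obtained by solving \<open>n s + E(s) = B + i \<theta>\<close>.
\<close>

lemma end_loop:
  assumes n: "n \<ge> 1" and r: "r > 0" and holf: "f holomorphic_on ball 0 r" and holg: "g holomorphic_on ball 0 r"
    and lt: "cmod (g 0) < cmod (f 0)"
  defines "x \<equiv> \<lambda>z. g z / z ^ n + cnj (f z / z ^ n)"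
  obtains Z :: "real \<Rightarrow> complex" where "continuous_on UNIV Z" "\<And>\<theta>. Z \<theta> \<in> punctured_disc r"
    "\<And>\<theta>. x (Z (\<theta> + 2 * pi)) = x (Z \<theta>)" "\<And>\<theta>. Z (\<theta> + of_nat n * (2 * pi)) = Z \<theta>"
    "\<And>\<theta>. n \<ge> 2 \<Longrightarrow> Z (\<theta> + 2 * pi) \<noteq> Z \<theta>"
proof -
  have f0: "f 0 \<noteq> 0" using lt by auto
  define h0 where "h0 = g 0 / f 0"
  \<comment> \<open>\<open>J = 1 - |h0|^2\<close> is the denominator in the inverse of
    \<open>L\<close>, which is \<open>w \<mapsto> (cnj w - cnj h0 * w) / J\<close>.\<close>
  define J :: complex where "J = 1 - h0 * cnj h0"
  have "cmod h0 < 1" using lt f0 by (simp add: h0_def norm_divide)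
  then have "(cmod h0)\<^sup>2 < 1" by (simp add: power_less_one_iff)
  then have J: "J \<noteq> 0"
    unfolding J_def by (metis complex_norm_square eq_iff_diff_eq_0 less_irrefl of_real_1 of_real_eq_iff)
  define L where "L y = cnj y + h0 * y" for y
  define m where "m z = (g z - h0 * f z) / f 0" for z
  define m1 where "m1 z = f z / f 0 - 1" for z
  \<comment> \<open>With \<open>P = 1 / z ^ n\<close> one has \<open>x = L (f P) + f(0) P m\<close>.
    Applying the inverse of \<open>L\<close> and dividing by \<open>f(0) P\<close> gives
    \<open>1 + q\<close>; the factor \<open>(z / cnj z) ^ n\<close> is
    \<open>cnj P / P\<close>.\<close>
  define q where "q z = m1 z + (cnj (f 0) / (f 0 * J) * ((z / cnj z) ^ n * cnj (m z)) + (- (cnj h0 / J)) * m z)" for z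
  have W: "exp (- s) / cnj (exp (- s)) = exp (\<i> * of_real (- 2 * Im s))" for s
  proof -
    have "exp (- s) / cnj (exp (- s)) = exp (- s - cnj (- s))"
      by (simp only: exp_cnj exp_diff)
    also have "- s - cnj (- s) = \<i> * of_real (- 2 * Im s)" by (simp add: complex_eq_iff)
    finally show ?thesis .
  qed
  have Wn: "(exp (- s) / cnj (exp (- s))) ^ n = exp (\<i> * of_real (- (2 * of_nat n) * Im s))" for s
    unfolding W by (simp add: exp_of_nat_mult[symmetric] algebra_simps)
  have slm: "small_lipschitz (\<lambda>s. m (exp (- s)))"
    using f0 r by (intro small_lipschitz_exp[of _ r])
      (auto simp: m_def h0_def intro!: holomorphic_intros holf holg)
  have "small_lipschitz (\<lambda>s. m1 (exp (- s)))"
    using f0 r by (intro small_lipschitz_exp[of _ r])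
      (auto simp: m1_def intro!: holomorphic_intros holf)
  moreover have "small_lipschitz (\<lambda>s. (exp (- s) / cnj (exp (- s))) ^ n * cnj (m (exp (- s))))"
  proof (rule small_lipschitz_mult[of _ "1 + 2 * of_nat n"])
    fix s s'
    show "cmod ((exp (- s) / cnj (exp (- s))) ^ n) \<le> 1 + 2 * of_nat n"
      unfolding Wn norm_exp_i_times by simp
    have "cmod ((exp (- s) / cnj (exp (- s))) ^ n - (exp (- s') / cnj (exp (- s'))) ^ n)
        \<le> \<bar>- (2 * of_nat n) * Im s - - (2 * of_nat n) * Im s'\<bar>"
      unfolding Wn by (rule exp_lipschitz_imaginary)
    also have "- (2 * of_nat n) * Im s - - (2 * of_nat n) * Im s' = - (2 * of_nat n) * Im (s - s')"
      by (simp add: algebra_simps)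
    also have "\<bar>\<dots>\<bar> = 2 * of_nat n * \<bar>Im (s - s')\<bar>" by (simp add: abs_mult)
    also have "\<dots> \<le> (1 + 2 * of_nat n) * cmod (s - s')"
      by (intro mult_mono abs_Im_le_cmod) auto
    finally show "cmod ((exp (- s) / cnj (exp (- s))) ^ n - (exp (- s') / cnj (exp (- s'))) ^ n)
        \<le> (1 + 2 * of_nat n) * cmod (s - s')" .
  qed (intro small_lipschitz_cnj slm)
  ultimately have slq: "small_lipschitz (\<lambda>s. q (exp (- s)))"
    unfolding q_def by (intro small_lipschitz_add small_lipschitz_cmult slm)
  define E where "E s = Ln (1 + q (exp (- s)))" for s
  have slE: "small_lipschitz E"
    unfolding E_def by (rule small_lipschitz_Ln[OF slq])
  have half: "(1/2 :: real) > 0" and quarter: "(1/4 :: real) > 0" by simp_all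
  obtain A1 where A1: "\<And>s. A1 \<le> Re s \<Longrightarrow> cmod (q (exp (- s))) \<le> 1/2"
     "\<And>s s'. A1 \<le> Re s \<Longrightarrow> A1 \<le> Re s' \<Longrightarrow> cmod (q (exp (- s)) - q (exp (- s'))) \<le> 1/2 * cmod (s - s')"
    using small_lipschitzE[OF slq half] by blast
  obtain A2 where A2: "\<And>s. A2 \<le> Re s \<Longrightarrow> cmod (E s) \<le> 1/4"
     "\<And>s s'. A2 \<le> Re s \<Longrightarrow> A2 \<le> Re s' \<Longrightarrow> cmod (E s - E s') \<le> 1/4 * cmod (s - s')"
    using small_lipschitzE[OF slE quarter] by blast
  \<comment> \<open>To the right of \<open>A\<close>, |q| \<le> 1/2, so that \<open>1 + q\<close> is
    nonzero and has a logarithm; \<open>E\<close> satisfies the bounds for the fixed point argument;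
    and \<open>exp (- s)\<close> has modulus at most \<open>r * exp (- 1)\<close>.\<close>
  define A where "A = Max {A1, A2, 1 - ln r}"
  have A: "A1 \<le> A" "A2 \<le> A" "1 - ln r \<le> A" by (auto simp: A_def)
  obtain Y B where Y: "\<And>y. B \<le> Re y \<Longrightarrow> A \<le> Re (Y y) \<and> of_nat n * Y y + E (Y y) = y"
    and contY: "continuous_on {y. B \<le> Re y} Y"
    and uniq: "\<And>y s. B \<le> Re y \<Longrightarrow> A \<le> Re s \<Longrightarrow> of_nat n * s + E s = y \<Longrightarrow> s = Y y"
    by (rule inverse_near_linear[OF n, of A E]) (use A A2 in \<open>auto intro: order_trans\<close>)
  have x: "x (exp (- s)) = L (f 0 * exp (of_nat n * s + E s))" if "A \<le> Re s" for s
  proof -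
    define z where "z = exp (- s)"
    define P where "P = exp (of_nat n * s)"
    have "cmod (q z) \<le> 1/2" using A1(1)[of s] A that unfolding z_def by simp
    then have "1 + q z \<noteq> 0" by (auto simp: add_eq_0_iff)
    then have e: "exp (of_nat n * s + E s) = P * (1 + q z)"
      unfolding E_def exp_add P_def z_def[symmetric] by simp
    have P: "1 / z ^ n = P" unfolding z_def P_def
      by (simp add: exp_minus exp_of_nat_mult[symmetric] field_simps)
    have PW: "P * (z / cnj z) ^ n = cnj P"
    proof -
      have "of_nat n * s + \<i> * of_real (- (2 * of_nat n) * Im s) = cnj (of_nat n * s)"
        by (simp add: complex_eq_iff)
      then show ?thesis
        unfolding z_def Wn P_def exp_add[symmetric] by (simp only: exp_cnj)
    qed
    define M where "M = f 0 * P * m z"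
    have M: "M = g z * P - h0 * (f z * P)" unfolding M_def m_def using f0 by (simp add: field_simps)
    have "f 0 * (P * (1 + q z)) = f z * P + (cnj (f 0) * (P * (z / cnj z) ^ n) * cnj (m z) - cnj h0 * (f 0 * P * m z)) / J"
      unfolding q_def m1_def using f0 J by (simp add: field_simps)
    also have "\<dots> = f z * P + (cnj M - cnj h0 * M) / J"
      unfolding PW M_def by simp
    finally have u: "f 0 * (P * (1 + q z)) = f z * P + (cnj M - cnj h0 * M) / J" .
    have cJ: "cnj J = J" unfolding J_def by (simp add: mult.commute)
    have "L (f 0 * exp (of_nat n * s + E s)) = cnj (f z * P) + h0 * (f z * P) + (M - h0 * cnj M + h0 * (cnj M - cnj h0 * M)) / J"
      unfolding e u L_def by (simp add: cJ add_divide_distrib diff_divide_distrib algebra_simps)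
    also have "M - h0 * cnj M + h0 * (cnj M - cnj h0 * M) = M * J"
      unfolding J_def by (simp add: algebra_simps)
    also have "cnj (f z * P) + h0 * (f z * P) + M * J / J = x z"
      using J unfolding M x_def P[symmetric] by simp
    finally show ?thesis unfolding z_def by simp
  qed
  have E_per: "E s = E s'" if "exp (- s) = exp (- s')" for s s'
    unfolding E_def that by simp
  define Z where "Z \<theta> = exp (- Y (of_real B + \<i> * of_real \<theta>))" for \<theta>
  have RB: "B \<le> Re (of_real B + \<i> * of_real \<theta>)" for \<theta> by simp
  show ?thesis
  proof (rule that[of Z])
    show "continuous_on UNIV Z"
      unfolding Z_def by (intro continuous_intros continuous_on_compose2[OF contY]) auto
    fix \<theta>
    let ?y = "of_real B + \<i> * of_real \<theta>"
    let ?y1 = "of_real B + \<i> * of_real (\<theta> + 2 * pi)"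
    let ?yn = "of_real B + \<i> * of_real (\<theta> + of_nat n * (2 * pi))"
    note Yy = Y[OF RB[of \<theta>]]
    note Yy1 = Y[OF RB[of "\<theta> + 2 * pi"]]
    have "cmod (Z \<theta>) = exp (- Re (Y ?y))" unfolding Z_def by simp
    also have "\<dots> \<le> exp (ln r - 1)" using Yy A(3) by simp
    also have "\<dots> < exp (ln r)" by simp
    finally show "Z \<theta> \<in> punctured_disc r" using r by (simp add: Z_def)
    have "x (Z (\<theta> + 2 * pi)) = L (f 0 * exp ?y1)"
      unfolding Z_def using x[of "Y ?y1"] Yy1 by simp
    also have "?y1 = ?y + 2 * of_real pi * \<i>" by (simp add: algebra_simps)
    also have "exp \<dots> = exp ?y" by (simp add: exp_add)
    also have "L (f 0 * exp ?y) = x (Z \<theta>)"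
      unfolding Z_def using x[of "Y ?y"] Yy by simp
    finally show "x (Z (\<theta> + 2 * pi)) = x (Z \<theta>)" .
    have per: "exp (- (Y ?y + 2 * of_real pi * \<i>)) = exp (- Y ?y)"
      by (simp add: exp_diff)
    \<comment> \<open>\<open>E\<close> depends on \<open>exp (- s)\<close> only, so adding 2\<pi>i
      to a solution adds 2\<pi>i n to the right-hand side; by uniqueness the loop closes after
      \<open>n\<close> turns.\<close>
    have "Y ?y + 2 * of_real pi * \<i> = Y ?yn"
    proof (rule uniq[OF RB])
      show "A \<le> Re (Y ?y + 2 * of_real pi * \<i>)" using Yy by simp
      show "of_nat n * (Y ?y + 2 * of_real pi * \<i>) + E (Y ?y + 2 * of_real pi * \<i>) = ?yn"
        unfolding E_per[OF per] using Yy by (simp add: algebra_simps)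
    qed
    then show "Z (\<theta> + of_nat n * (2 * pi)) = Z \<theta>"
      unfolding Z_def using per by simp
    show "Z (\<theta> + 2 * pi) \<noteq> Z \<theta>" if n2: "n \<ge> 2"
    proof
      \<comment> \<open>Equal points force the two solutions to differ by an integer multiple of
        2\<pi>i, with the same value of \<open>E\<close>; subtracting the equations makes
        \<open>n\<close> a divisor of 1.\<close>
      assume "Z (\<theta> + 2 * pi) = Z \<theta>"
      then have eq: "exp (- Y ?y1) = exp (- Y ?y)" unfolding Z_def .
      then obtain k :: int where k: "- Y ?y1 = - Y ?y + of_real (of_int (2 * k) * pi) * \<i>"
        unfolding exp_eq by blast
      have "of_nat n * (Y ?y1 - Y ?y) = (of_nat n * Y ?y1 + E (Y ?y1)) - (of_nat n * Y ?y + E (Y ?y))"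
        unfolding E_per[OF eq] by (simp add: right_diff_distrib)
      also have "\<dots> = ?y1 - ?y" using Yy Yy1 by (simp only:)
      finally have "of_nat n * (Y ?y1 - Y ?y) = 2 * of_real pi * \<i>" by (simp add: algebra_simps)
      moreover have "Y ?y1 - Y ?y = - (of_real (of_int (2 * k) * pi) * \<i>)"
        using arg_cong[OF k, of uminus] by simp
      ultimately have "of_nat n * (- (of_real (of_int (2 * k) * pi) * \<i>)) = 2 * of_real pi * \<i>"
        by (simp only:)
      then have "(2 * of_real pi * \<i>) * of_int (int n * - k) = (2 * of_real pi * \<i>) * of_int 1"
        by (simp add: mult_ac)
      then have "of_int (int n * - k) = (of_int 1 :: complex)"
        by (rule mult_left_cancel[THEN iffD1, rotated]) simp
      then have "int n * - k = 1" unfolding of_int_eq_iff .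
      then have "int n dvd 1" by (metis dvd_triv_left)
      then show False using n2 zdvd_imp_le[OF _ zero_less_one] by fastforce
    qed
  qed
qed

text \<open>\<open>end_loop\<close> supplies pairs of distinct points with the same horizontal part,
  and \<open>periodic_chord\<close> picks a pair whose heights agree as well.\<close>

lemma not_injective_multiple_end:
  assumes n: "n \<ge> 2" and r: "r > 0" and holf: "f holomorphic_on ball 0 r" and holg: "g holomorphic_on ball 0 r"
    and lt: "cmod (g 0) < cmod (f 0)"
    and \<psi>: "\<And>z. z \<in> punctured_disc r \<Longrightarrow> fst (\<psi> z) = g z / z ^ n + cnj (f z / z ^ n)"
    and cont: "continuous_on (punctured_disc r) \<psi>"
  shows "\<not> inj_on (\<psi> :: complex \<Rightarrow> complex \<times> real) (punctured_disc r)"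
proof
  assume inj: "inj_on \<psi> (punctured_disc r)"
  have n1: "n \<ge> 1" using n by simp
  obtain Z :: "real \<Rightarrow> complex" where Z: "continuous_on UNIV Z" "\<And>\<theta>. Z \<theta> \<in> punctured_disc r"
    "\<And>\<theta>. fst (\<psi> (Z (\<theta> + 2 * pi))) = fst (\<psi> (Z \<theta>))" "\<And>\<theta>. Z (\<theta> + of_nat n * (2 * pi)) = Z \<theta>"
    "\<And>\<theta>. Z (\<theta> + 2 * pi) \<noteq> Z \<theta>"
    using end_loop[OF n1 r holf holg lt] \<psi> n by (metis (no_types, lifting))
  have "continuous_on UNIV (\<lambda>\<theta>. snd (\<psi> (Z \<theta>)))"
    using Z(1,2) by (intro continuous_on_snd continuous_on_compose2[OF cont]) auto
  then obtain \<theta> where "snd (\<psi> (Z (\<theta> + 2 * pi))) = snd (\<psi> (Z \<theta>))"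
    using periodic_chord[of "\<lambda>\<theta>. snd (\<psi> (Z \<theta>))" n "2 * pi"] n1 Z(4)[of 0] by auto
  then have "\<psi> (Z (\<theta> + 2 * pi)) = \<psi> (Z \<theta>)" using Z(3) by (simp add: prod_eq_iff)
  then show False using inj_onD[OF inj _ Z(2) Z(2)] Z(5) by blast
qed

section \<open>Simple ends\<close>

text \<open>Only the horizontal part of the derivative is recorded: when one of \<open>F'\<close>,
  \<open>G'\<close> dominates, it already makes the derivative injective.\<close>

lemma affine_rep_has_derivative:
  assumes rep: "affine_rep S F G \<psi> R" and S: "open S" and hol: "F holomorphic_on S" "G holomorphic_on S"
    and z: "z \<in> S"
  obtains D where "(\<psi> has_derivative D) (at z)" "\<And>v. fst (D v) = deriv G z * v + cnj (deriv F z * v)"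
proof -
  define t where "t z = 1/2 * ((cmod (G z))\<^sup>2 - (cmod (F z))\<^sup>2) + Re (G z * F z) - 2 * R z" for z
  have G: "(G has_derivative (\<lambda>v. deriv G z * v)) (at z)" and F: "(F has_derivative (\<lambda>v. deriv F z * v)) (at z)"
    using holomorphic_derivI[OF _ S z] hol by (auto simp: has_field_derivative_def)
  have R: "(R has_derivative (\<lambda>v. Re (F z * deriv G z * v))) (at z)"
    using rep z unfolding affine_rep_def by blast
  have "\<exists>D. (t has_derivative D) (at z)"
    unfolding t_def cmod_power2
    by (rule exI, (rule derivative_intros has_derivative_Re has_derivative_Im F G R)+)
  then obtain D where D: "(t has_derivative D) (at z)" by blast
  have "((\<lambda>z. (G z + cnj (F z), t z)) has_derivative (\<lambda>v. (deriv G z * v + cnj (deriv F z * v), D v))) (at z)"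
    by (intro has_derivative_Pair D has_derivative_add G has_derivative_cnj F)
  then have "(\<psi> has_derivative (\<lambda>v. (deriv G z * v + cnj (deriv F z * v), D v))) (at z)"
    by (rule has_derivative_transform_within_open[OF _ S z]) (use rep in \<open>auto simp: affine_rep_def t_def\<close>)
  then show ?thesis by (rule that) simp
qed

text \<open>A kernel vector satisfies |A v| = |B v|, which the strict inequality allows only for
  \<open>v = 0\<close>.\<close>

lemma antiholomorphic_dominated_injective:
  fixes A B :: complex
  assumes "cmod A < cmod B" "\<And>v. fst (D v) = A * v + cnj (B * v)" "linear D"
  shows "inj (D :: complex \<Rightarrow> complex \<times> real)"
proof (rule linear_injective_0[THEN iffD2, rule_format])
  fix v assume "D v = 0"
  then have "A * v + cnj (B * v) = 0" using assms(2)[of v] by simp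
  then have "A * v = - cnj (B * v)" by (simp add: add_eq_0_iff2)
  then have "cmod A * cmod v = cmod B * cmod v"
    by (metis complex_mod_cnj norm_minus_cancel norm_mult)
  then show "v = 0" using assms(1) by simp
qed (fact assms(3))

text \<open>The expansion gives injectivity and a 1-Lipschitz inverse at once.\<close>

lemma embedding_map_of_expanding:
  fixes \<psi> :: "complex \<Rightarrow> complex \<times> real"
  assumes cont: "continuous_on S \<psi>"
    and exp: "\<And>z w. z \<in> S \<Longrightarrow> w \<in> S \<Longrightarrow> dist z w \<le> dist (\<psi> z) (\<psi> w)"
  shows "embedding_map (top_of_set S) euclidean \<psi>"
proof -
  have inj: "inj_on \<psi> S"
    using exp by (intro inj_onI) (metis dist_self dist_le_zero_iff)
  let ?\<theta> = "inv_into S \<psi>"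
  have "continuous_on (\<psi> ` S) ?\<theta>"
    unfolding continuous_on_iff
  proof (intro ballI allI impI)
    fix p and e :: real assume p: "p \<in> \<psi> ` S" and e: "e > 0"
    have "dist (?\<theta> q) (?\<theta> p) < e" if "q \<in> \<psi> ` S" "dist q p < e" for q
      using exp[of "?\<theta> q" "?\<theta> p"] that p by (auto simp: inv_into_f_f[OF inj])
    then show "\<exists>d>0. \<forall>q\<in>\<psi> ` S. dist q p < d \<longrightarrow> dist (?\<theta> q) (?\<theta> p) < e"
      using e by blast
  qed
  then have "homeomorphic_maps (top_of_set S) (top_of_set (\<psi> ` S)) \<psi> ?\<theta>"
    unfolding homeomorphic_maps_def using cont inj
    by (auto simp: continuous_map_subtopology_eu inv_into_f_f inv_into_into)
  then show ?thesis
    unfolding embedding_map_def homeomorphic_map_maps by auto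
qed

text \<open>Here \<open>x = cnj F + h0 F + k\<close> with |h0| < 1 and \<open>k\<close> holomorphic
  at 0. The term \<open>cnj F\<close> outweighs \<open>h0 F\<close> by a fixed proportion, and it
  outweighs \<open>k\<close> because \<open>F\<close> expands distances by an arbitrarily large
  factor near its pole; so \<open>x\<close> itself is expanding.\<close>

lemma simple_end_embedded:
  assumes \<epsilon>: "\<epsilon> > 0" and holF: "F holomorphic_on punctured_disc \<epsilon>" and holG: "G holomorphic_on punctured_disc \<epsilon>"
    and f: "f holomorphic_on ball 0 \<epsilon>" and g: "g holomorphic_on ball 0 \<epsilon>"
    and F: "\<And>z. z \<in> punctured_disc \<epsilon> \<Longrightarrow> F z = f z / z" and G: "\<And>z. z \<in> punctured_disc \<epsilon> \<Longrightarrow> G z = g z / z"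
    and fg: "cmod (g 0) < cmod (f 0)"
    and lt: "\<And>z. z \<in> punctured_disc \<epsilon> \<Longrightarrow> cmod (deriv G z) < cmod (deriv F z)"
    and rep: "affine_rep (punctured_disc \<epsilon>) F G \<psi> R"
  shows "embedded_end \<epsilon> \<psi>"
proof -
  have f0: "f 0 \<noteq> 0" using fg by auto
  define h0 where "h0 = g 0 / f 0"
  have h0: "cmod h0 < 1" using fg f0 by (simp add: h0_def norm_divide)
  have "(\<lambda>z. g z - h0 * f z) holomorphic_on ball 0 \<epsilon>" using f g by (intro holomorphic_intros)
  then obtain k where k: "k holomorphic_on ball 0 \<epsilon>" "\<And>z. g z - h0 * f z = z * k z"
    using holomorphic_divide_zero[of "\<lambda>z. g z - h0 * f z" \<epsilon>] \<epsilon> f0 by (auto simp: h0_def)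
  have GF: "G z = h0 * F z + k z" if "z \<in> punctured_disc \<epsilon>" for z
    unfolding F[OF that] G[OF that] using k(2)[of z] that by (simp add: field_simps)
  have e2: "0 \<le> \<epsilon>/2" "\<epsilon>/2 < \<epsilon>" using \<epsilon> by auto
  obtain M where M: "M > 0"
    "\<And>x y. x \<in> cball 0 (\<epsilon>/2) \<Longrightarrow> y \<in> cball 0 (\<epsilon>/2) \<Longrightarrow> cmod (k x - k y) \<le> M * cmod (x - y)"
    using holomorphic_lipschitz[OF k(1) e2] by metis
  obtain N where N: "N > 0"
    "\<And>x y. x \<in> cball 0 (\<epsilon>/2) \<Longrightarrow> y \<in> cball 0 (\<epsilon>/2) \<Longrightarrow> cmod (f x - f y) \<le> N * cmod (x - y)"
    using holomorphic_lipschitz[OF f e2] by metis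
  define c where "c = cmod (f 0) / 2"
  define s where "s = (1 - cmod h0) * c"
  have cs: "c > 0" "s > 0" using f0 h0 by (auto simp: c_def s_def)
  \<comment> \<open>\<open>c / (2 * N)\<close> keeps \<open>f\<close> close to \<open>f(0)\<close>;
    \<open>s / (M + 1)\<close> makes the gain from \<open>F\<close> at least \<open>M + 1\<close>,
    of which \<open>k\<close> can cost \<open>M\<close>; the bound 1 gives |z w| \<le> r.\<close>
  define r where "r = Min {\<epsilon>/2, c / (2 * N), s / (M + 1), 1}"
  have "r > 0" using \<epsilon> M(1) N(1) cs by (simp add: r_def)
  have "r \<le> \<epsilon>/2" "r \<le> c / (2 * N)" "r \<le> s / (M + 1)" "r \<le> 1"
    unfolding r_def by (rule Min_le; simp)+
  then have r: "r \<le> \<epsilon>/2" "2 * (N * r) \<le> c" "r * (M + 1) \<le> s" "r \<le> 1"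
    using M(1) N(1) by (auto simp: field_simps)
  have sub: "punctured_disc r \<subseteq> punctured_disc \<epsilon>" using r \<epsilon> by (intro punctured_disc_mono) simp
  have exp: "cmod (z - w) \<le> cmod ((G z + cnj (F z)) - (G w + cnj (F w)))"
    if z: "z \<in> punctured_disc r" and w: "w \<in> punctured_disc r" for z w
  proof -
    have zw: "z \<in> cball 0 (\<epsilon>/2)" "w \<in> cball 0 (\<epsilon>/2)" "(0::complex) \<in> cball 0 (\<epsilon>/2)" using z w r \<epsilon> by auto
    have nz: "z \<noteq> 0" "w \<noteq> 0" "cmod z < r" "cmod w < r" using z w by auto
    let ?d = "cmod (z - w)"
    have "cmod (f 0) - cmod (f z) \<le> cmod (f z - f 0)"
      by (metis norm_minus_commute norm_triangle_ineq2)
    also have "\<dots> \<le> N * cmod z" using N(2)[OF zw(1,3)] by simp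
    also have "\<dots> \<le> N * r" using nz N(1) by (intro mult_left_mono) auto
    finally have fz: "2 * c - N * r \<le> cmod (f z)" by (simp add: c_def)
    \<comment> \<open>The numerator of \<open>F z - F w\<close> is dominated by
      \<open>f z * (z - w)\<close>; the other term has the small factor \<open>z\<close>.\<close>
    have "f z * w - f w * z = z * (f z - f w) - f z * (z - w)" by (simp add: algebra_simps)
    then have "cmod (f z) * ?d - cmod z * cmod (f z - f w) \<le> cmod (f z * w - f w * z)"
      by (metis norm_minus_commute norm_mult norm_triangle_ineq2)
    moreover have "cmod z * cmod (f z - f w) \<le> r * (N * ?d)"
      using nz N(2)[OF zw(1,2)] \<open>r > 0\<close> by (intro mult_mono) auto
    moreover have "(2 * c - N * r) * ?d \<le> cmod (f z) * ?d" using fz by (intro mult_right_mono) auto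
    ultimately have "(2 * c - 2 * (N * r)) * ?d \<le> cmod (f z * w - f w * z)" by (simp add: algebra_simps)
    moreover have "c * ?d \<le> (2 * c - 2 * (N * r)) * ?d" using r by (intro mult_right_mono) auto
    ultimately have num: "c * ?d \<le> cmod (f z * w - f w * z)" by linarith
    have "F z - F w = (f z * w - f w * z) / (z * w)"
      using F z w sub nz by (simp add: subset_iff field_simps)
    then have "cmod (F z - F w) * (cmod z * cmod w) = cmod (f z * w - f w * z)"
      using nz by (simp add: norm_divide norm_mult)
    moreover have "cmod (F z - F w) * (cmod z * cmod w) \<le> cmod (F z - F w) * (r * 1)"
      using nz r(4) \<open>r > 0\<close> by (intro mult_left_mono mult_mono) auto
    ultimately have FF: "c * ?d \<le> cmod (F z - F w) * r" using num by simp
    have "(G z + cnj (F z)) - (G w + cnj (F w)) = cnj (F z - F w) - (- (h0 * (F z - F w)) - (k z - k w))"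
      using GF z w sub by (simp add: subset_iff algebra_simps)
    then have "cmod (cnj (F z - F w)) - cmod (- (h0 * (F z - F w)) - (k z - k w)) \<le> cmod ((G z + cnj (F z)) - (G w + cnj (F w)))"
      by (metis norm_triangle_ineq2)
    moreover have "cmod (- (h0 * (F z - F w)) - (k z - k w)) \<le> cmod h0 * cmod (F z - F w) + M * ?d"
      using norm_triangle_ineq4[of "- (h0 * (F z - F w))" "k z - k w"] M(2)[OF zw(1,2)] by (simp add: norm_mult)
    ultimately have main: "(1 - cmod h0) * cmod (F z - F w) - M * ?d \<le> cmod ((G z + cnj (F z)) - (G w + cnj (F w)))"
      unfolding complex_mod_cnj left_diff_distrib mult_1_left by linarith
    have "r * ((M + 1) * ?d) \<le> s * ?d"
      using r(3) by (simp add: mult.assoc[symmetric] mult_right_mono)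
    also have "\<dots> = (1 - cmod h0) * (c * ?d)" by (simp add: s_def)
    also have "\<dots> \<le> (1 - cmod h0) * (cmod (F z - F w) * r)" using FF h0 by (intro mult_left_mono) auto
    also have "\<dots> = r * ((1 - cmod h0) * cmod (F z - F w))" by simp
    finally have "(M + 1) * ?d \<le> (1 - cmod h0) * cmod (F z - F w)" using \<open>r > 0\<close> by simp
    then show ?thesis using main by (simp add: algebra_simps)
  qed
  have fst\<psi>: "fst (\<psi> z) = G z + cnj (F z)" if "z \<in> punctured_disc \<epsilon>" for z
    using rep that unfolding affine_rep_def by auto
  have der: "\<exists>D. (\<psi> has_derivative D) (at z) \<and> inj D" if z: "z \<in> punctured_disc r" for z
  proof -
    have z': "z \<in> punctured_disc \<epsilon>" using z sub by blast
    obtain D where D: "(\<psi> has_derivative D) (at z)" "\<And>v. fst (D v) = deriv G z * v + cnj (deriv F z * v)"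
      using affine_rep_has_derivative[OF rep open_punctured_disc holF holG z'] by blast
    then have "inj D"
      using lt[OF z'] has_derivative_linear by (intro antiholomorphic_dominated_injective) auto
    then show ?thesis using D by blast
  qed
  have "continuous_on (punctured_disc r) \<psi>"
    using der by (meson continuous_at_imp_continuous_on has_derivative_continuous)
  then have "embedding_map (top_of_set (punctured_disc r)) euclidean \<psi>"
  proof (rule embedding_map_of_expanding)
    fix z w assume zw: "z \<in> punctured_disc r" "w \<in> punctured_disc r"
    have "dist z w \<le> cmod (fst (\<psi> z) - fst (\<psi> w))"
      using exp[OF zw] zw sub by (simp add: fst\<psi> subset_iff dist_norm)
    also have "\<dots> \<le> dist (\<psi> z) (\<psi> w)" unfolding dist_norm[symmetric] by (rule dist_fst_le)
    finally show "dist z w \<le> dist (\<psi> z) (\<psi> w)" .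
  qed
  then show ?thesis
    unfolding embedded_end_def using \<open>r > 0\<close> r \<epsilon> der
    by (intro exI[of _ "ball 0 r"]) (auto simp: punctured_disc_def[symmetric] simp del: punctured_disc_iff)
qed

section \<open>Asymptotics of simple ends\<close>

lemma has_derivative_add_Re:
  assumes "(R has_derivative (\<lambda>v. Re (A * v))) (at z)" "(K has_field_derivative B) (at z)"
  shows "((\<lambda>z. R z + Re (K z)) has_derivative (\<lambda>v. Re ((A + B) * v))) (at z)"
  unfolding distrib_right plus_complex.sel
  by (rule has_derivative_add[OF assms(1) Re_has_derivative[OF assms(2)]])

lemma has_derivative_diff_Re:
  assumes "(R has_derivative (\<lambda>v. Re (A * v))) (at z)" "(K has_field_derivative B) (at z)"
  shows "((\<lambda>z. R z - Re (K z)) has_derivative (\<lambda>v. Re ((A - B) * v))) (at z)"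
  unfolding left_diff_distrib minus_complex.sel
  by (rule has_derivative_diff[OF assms(1) Re_has_derivative[OF assms(2)]])

text \<open>The period of \<alpha> dz / z on a circle is 2\<pi>i \<alpha>, and a single-valued
  \<open>Q\<close> forces the real part of this period to vanish.\<close>

lemma log_primitive_real:
  assumes r: "r > 0" and Q: "\<And>z. z \<in> punctured_disc r \<Longrightarrow> (Q has_derivative (\<lambda>v. Re (\<alpha> / z * v))) (at z)"
  shows "Im \<alpha> = 0"
proof -
  define c where "c \<theta> = of_real (r/2) * exp (\<i> * of_real \<theta>)" for \<theta>
  have c: "c \<theta> \<in> punctured_disc r" for \<theta>
    using r by (simp add: c_def norm_mult)
  have dc: "(c has_derivative (\<lambda>h. of_real h * (\<i> * c \<theta>))) (at \<theta>)" for \<theta>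
  proof -
    have "((\<lambda>\<theta>. \<i> * of_real \<theta> :: complex) has_derivative (\<lambda>h. \<i> * of_real h)) (at \<theta>)"
      by (auto intro!: derivative_eq_intros)
    from has_derivative_compose[OF this DERIV_exp[THEN has_field_derivative_imp_has_derivative]]
    have "((\<lambda>\<theta>. exp (\<i> * of_real \<theta>)) has_derivative (\<lambda>h. exp (\<i> * of_real \<theta>) * (\<i> * of_real h))) (at \<theta>)" .
    from has_derivative_mult_right[OF this, of "of_real (r/2)"]
    show ?thesis unfolding c_def by (simp add: mult_ac)
  qed
  have "((\<lambda>\<theta>. Q (c \<theta>) + \<theta> * Im \<alpha>) has_derivative (\<lambda>h. 0)) (at \<theta>)" for \<theta>
  proof -
    have eq: "\<alpha> / c \<theta> * (of_real h * (\<i> * c \<theta>)) = of_real h * (\<i> * \<alpha>)" for h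
      using c[of \<theta>] by (simp add: field_simps)
    have "((\<lambda>\<theta>. Q (c \<theta>)) has_derivative (\<lambda>h. Re (\<alpha> / c \<theta> * (of_real h * (\<i> * c \<theta>))))) (at \<theta>)"
      by (rule has_derivative_compose[OF dc Q[OF c]])
    then have "((\<lambda>\<theta>. Q (c \<theta>)) has_derivative (\<lambda>h. - (h * Im \<alpha>))) (at \<theta>)"
      unfolding eq by simp
    then show ?thesis by (auto intro!: derivative_eq_intros)
  qed
  then have "DERIV (\<lambda>\<theta>. Q (c \<theta>) + \<theta> * Im \<alpha>) \<theta> :> 0" for \<theta>
    unfolding has_field_derivative_def lambda_zero[symmetric] .
  then have "Q (c (2 * pi)) + (2 * pi) * Im \<alpha> = Q (c 0) + 0 * Im \<alpha>"
    by (intro DERIV_isconst_all) auto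
  moreover have "c (2 * pi) = c 0"
    unfolding c_def by (simp add: mult.commute[of \<i>])
  ultimately show ?thesis by simp
qed

text \<open>Primes on \<open>F\<close>, \<open>G\<close>, \<open>f\<close> and \<open>R\<close>
  denote the translated data, not derivatives. They satisfy \<open>F' = 1 / \<phi>\<close> and
  \<open>G' = b / \<phi> + \<alpha> \<phi> + \<eta>\<close> with \<open>\<eta>\<close> vanishing to
  second order, so \<open>\<eta>\<close> is the horizontal distance to the model. In the height,
  \<open>\<eta> F'\<close> tends to 0, and the integrals differ by \<open>Re K\<close> and a
  constant, where \<open>K\<close> is continuous at 0; the limit is absorbed by the motion.\<close>

lemma simple_end_asymptotic:
  assumes \<epsilon>: "\<epsilon> > 0" and holF: "F holomorphic_on punctured_disc \<epsilon>" and holG: "G holomorphic_on punctured_disc \<epsilon>"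
    and f: "f holomorphic_on ball 0 \<epsilon>" and g: "g holomorphic_on ball 0 \<epsilon>"
    and F: "\<And>z. z \<in> punctured_disc \<epsilon> \<Longrightarrow> F z = f z / z" and G: "\<And>z. z \<in> punctured_disc \<epsilon> \<Longrightarrow> G z = g z / z"
    and fg: "cmod (g 0) < cmod (f 0)"
    and rep: "affine_rep (punctured_disc \<epsilon>) F G \<psi> R"
  obtains a :: real and b where "cmod b < 1"
    "asymptotic_to \<epsilon> \<psi> (\<lambda>z. 1 / z) (\<lambda>z. of_real a * z + b / z)"
proof -
  have f0: "f 0 \<noteq> 0" using fg by auto
  define b where "b = g 0 / f 0"
  have b: "cmod b < 1" using fg f0 by (simp add: b_def norm_divide)
  have "(\<lambda>z. g z - b * f z) holomorphic_on ball 0 \<epsilon>" using f g by (intro holomorphic_intros)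
  then obtain k where k: "k holomorphic_on ball 0 \<epsilon>" "\<And>z. g z - b * f z = z * k z"
    using holomorphic_divide_zero[of "\<lambda>z. g z - b * f z" \<epsilon>] \<epsilon> f0 by (auto simp: b_def)
  define c where "c = k 0"
  \<comment> \<open>\<open>d\<close> solves the real-linear equation
    \<open>cnj d - b * d = - c\<close>, which cancels the constant term of \<open>G - b F\<close>.
    It is solvable because \<open>1 - |b|^2\<close> is nonzero.\<close>
  define d where "d = - (cnj c + c * cnj b) / (1 - b * cnj b)"
  have "(cmod b)\<^sup>2 < 1" using b by (simp add: power_less_one_iff)
  then have J: "1 - b * cnj b \<noteq> 0"
    by (metis complex_norm_square eq_iff_diff_eq_0 less_irrefl of_real_1 of_real_eq_iff)
  have d: "cnj d - b * d = - c"
  proof -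
    have cJ: "cnj (1 - b * cnj b) = 1 - b * cnj b" by (simp add: mult.commute)
    have "cnj d = - (c + cnj c * b) / (1 - b * cnj b)"
      unfolding d_def complex_cnj_divide cJ by simp
    then have "cnj d * (1 - b * cnj b) = - (c + cnj c * b)" using J by simp
    moreover have "d * (1 - b * cnj b) = - (cnj c + c * cnj b)" using J by (simp add: d_def)
    moreover have "(cnj d - b * d) * (1 - b * cnj b) = cnj d * (1 - b * cnj b) - b * (d * (1 - b * cnj b))"
      by (simp only: left_diff_distrib mult.assoc)
    ultimately have "(cnj d - b * d) * (1 - b * cnj b) = - (c + cnj c * b) - b * (- (cnj c + c * cnj b))"
      by (simp only:)
    also have "\<dots> = - c * (1 - b * cnj b)" by (simp add: algebra_simps)
    finally show ?thesis using J by (metis mult_right_cancel)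
  qed
  define F' where "F' z = F z + d" for z
  define G' where "G' z = G z + cnj d" for z
  define f' where "f' z = f z + d * z" for z
  define e where "e z = k z + cnj d - b * d" for z
  have holf': "f' holomorphic_on ball 0 \<epsilon>" unfolding f'_def using f by (intro holomorphic_intros)
  have hole: "e holomorphic_on ball 0 \<epsilon>" unfolding e_def using k by (intro holomorphic_intros)
  have e0: "e 0 = 0" using d by (simp only: e_def c_def add_diff_eq[symmetric] add.right_inverse)
  have f'0: "f' 0 \<noteq> 0" using f0 by (simp add: f'_def)
  have F': "F' z = f' z / z" if "z \<in> punctured_disc \<epsilon>" for z
    using that unfolding F'_def f'_def by (simp add: F field_simps)
  have G'F': "G' z = b * F' z + e z" if "z \<in> punctured_disc \<epsilon>" for z
  proof -
    have "G z = b * F z + k z"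
      using that k(2)[of z] by (simp add: F G field_simps)
    then show ?thesis unfolding G'_def F'_def e_def by (simp add: algebra_simps)
  qed
  have "isCont f' 0"
    using holf' \<epsilon> by (auto intro!: continuous_on_interior[of "ball 0 \<epsilon>"] holomorphic_on_imp_continuous_on)
  then obtain r0 where r0: "r0 > 0" "\<And>z. dist 0 z < r0 \<Longrightarrow> f' z \<noteq> 0"
    using continuous_at_avoid[of 0 f' 0] f'0 by auto
  define r where "r = min \<epsilon> r0"
  have r: "r > 0" "r \<le> \<epsilon>" and nz: "\<And>z. z \<in> ball 0 r \<Longrightarrow> f' z \<noteq> 0"
    using r0 \<epsilon> by (auto simp: r_def)
  have subr: "ball 0 r \<subseteq> ball (0::complex) \<epsilon>" using r by auto
  define \<phi> where "\<phi> z = z / f' z" for z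
  have hol\<phi>: "\<phi> holomorphic_on ball 0 r"
    unfolding \<phi>_def using nz holomorphic_on_subset[OF holf' subr] by (intro holomorphic_intros) auto
  have d\<phi>: "(\<phi> has_field_derivative (1 / f' z - z * deriv f' z / (f' z)\<^sup>2)) (at z)" if "z \<in> ball 0 r" for z
  proof -
    have "(f' has_field_derivative deriv f' z) (at z)"
      using that subr by (intro holomorphic_derivI[OF holf' open_ball]) auto
    then show ?thesis unfolding \<phi>_def using nz[OF that]
      by (auto intro!: derivative_eq_intros simp: field_simps power2_eq_square)
  qed
  have d\<phi>0: "deriv \<phi> 0 = 1 / f' 0" using d\<phi>[of 0] r by (intro DERIV_imp_deriv) simp
  obtain \<delta>0 where \<delta>0: "\<delta>0 > 0" "inj_on \<phi> (ball 0 \<delta>0)"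
    using has_complex_derivative_locally_injective[OF hol\<phi>, of 0] d\<phi>0 f'0 r by auto
  define \<delta> where "\<delta> = min r \<delta>0"
  have \<delta>: "\<delta> > 0" "\<delta> \<le> r" "\<delta> \<le> \<epsilon>"
    using r \<delta>0 by (auto simp: \<delta>_def)
  have inj: "inj_on \<phi> (punctured_disc \<delta>)"
    by (rule inj_on_subset[OF \<delta>0(2)]) (auto simp: \<delta>_def)
  have sub\<delta>: "punctured_disc \<delta> \<subseteq> punctured_disc \<epsilon>" "punctured_disc \<delta> \<subseteq> ball 0 r" "ball 0 \<delta> \<subseteq> ball (0::complex) r"
    using \<delta> by auto
  have \<phi>F': "1 / \<phi> z = F' z" "\<phi> z \<noteq> 0" if "z \<in> punctured_disc \<delta>" for z
    using F'[of z] nz[of z] that sub\<delta> by (auto simp: \<phi>_def)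
  \<comment> \<open>Since \<open>deriv \<phi> 0 = 1 / f' 0\<close>, this is the quotient of the
    linear coefficients of \<open>e\<close> and \<open>\<phi>\<close>; hence \<open>\<eta>\<close>
    has no linear term.\<close>
  define \<alpha> where "\<alpha> = deriv e 0 * f' 0"
  define \<eta> where "\<eta> z = e z - \<alpha> * \<phi> z" for z
  have hol\<eta>: "\<eta> holomorphic_on ball 0 r"
    unfolding \<eta>_def using holomorphic_on_subset[OF hole subr] hol\<phi> by (intro holomorphic_intros)
  have \<eta>0: "\<eta> 0 = 0" "deriv \<eta> 0 = 0"
  proof -
    show "\<eta> 0 = 0" by (simp add: \<eta>_def e0 \<phi>_def)
    have "(e has_field_derivative deriv e 0) (at 0)" "(\<phi> has_field_derivative deriv \<phi> 0) (at 0)"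
      using hole hol\<phi> \<epsilon> r by (auto intro!: holomorphic_derivI[of _ "ball 0 r"] intro: holomorphic_on_subset[OF _ subr])
    then have "(\<eta> has_field_derivative (deriv e 0 - \<alpha> * deriv \<phi> 0)) (at 0)"
      unfolding \<eta>_def by (intro DERIV_diff DERIV_cmult)
    then show "deriv \<eta> 0 = 0"
      using f'0 by (simp add: DERIV_imp_deriv \<alpha>_def d\<phi>0)
  qed
  have hold\<eta>: "deriv \<eta> holomorphic_on ball 0 r" using hol\<eta> by (intro holomorphic_deriv) auto
  obtain \<kappa> where \<kappa>: "\<kappa> holomorphic_on ball 0 r" "\<And>z. deriv \<eta> z = z * \<kappa> z"
    using holomorphic_divide_zero[OF hold\<eta> r(1) \<eta>0(2)] by metis
  obtain \<mu> where \<mu>: "\<mu> holomorphic_on ball 0 r" "\<And>z. \<eta> z = z * \<mu> z" "\<mu> 0 = 0"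
    using holomorphic_divide_zero[OF hol\<eta> r(1) \<eta>0(1)] \<eta>0(2) by metis
  \<comment> \<open>Since \<open>F' = f' / z\<close> and
    \<open>deriv \<eta> z = z * \<kappa> z\<close>, the product of the two is holomorphic at 0, and
    \<open>K\<close> is its primitive. \<open>K2\<close> below is a logarithm of \<open>f'\<close>
    up to a constant.\<close>
  have "(\<lambda>z. f' z * \<kappa> z) holomorphic_on ball 0 r"
    using holomorphic_on_subset[OF holf' subr] \<kappa>(1) by (intro holomorphic_intros)
  then obtain K where K: "\<And>z. z \<in> ball 0 r \<Longrightarrow> (K has_field_derivative (f' z * \<kappa> z)) (at z within ball 0 r)"
    by (rule holomorphic_convex_primitive'[OF convex_ball open_ball]) (rule that)
  have "(\<lambda>z. deriv f' z / f' z) holomorphic_on ball 0 r"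
    using holomorphic_on_subset[OF holomorphic_deriv[OF holf' open_ball] subr] holomorphic_on_subset[OF holf' subr] nz
    by (intro holomorphic_intros) auto
  then obtain K2 where K2: "\<And>z. z \<in> ball 0 r \<Longrightarrow> (K2 has_field_derivative (deriv f' z / f' z)) (at z within ball 0 r)"
    by (rule holomorphic_convex_primitive'[OF convex_ball open_ball]) (rule that)
  have K: "(K has_field_derivative (f' z * \<kappa> z)) (at z)" if "z \<in> ball 0 r" for z
    using K[OF that] unfolding at_within_open[OF that open_ball] .
  have K2: "(K2 has_field_derivative (deriv f' z / f' z)) (at z)" if "z \<in> ball 0 r" for z
    using K2[OF that] unfolding at_within_open[OF that open_ball] .
  define R' where "R' z = R z + Re (d * G z)" for z
  have rep': "affine_rep (punctured_disc \<epsilon>) F' G' (\<lambda>z. \<psi> z + (2 * cnj d, (cmod d)\<^sup>2)) R'"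
    unfolding F'_def[abs_def] G'_def[abs_def] R'_def[abs_def]
    by (rule affine_rep_translate[OF rep open_punctured_disc holF holG])
  have holF': "F' holomorphic_on punctured_disc \<delta>" "G' holomorphic_on punctured_disc \<delta>"
    unfolding F'_def G'_def using holomorphic_on_subset[OF _ sub\<delta>(1)] holF holG by (auto intro!: holomorphic_intros)
  have dG': "deriv G' z = b * deriv F' z + \<alpha> * deriv \<phi> z + deriv \<eta> z" and dF': "(F' has_field_derivative deriv F' z) (at z)"
    and d\<phi>z: "(\<phi> has_field_derivative deriv \<phi> z) (at z)"
    if z: "z \<in> punctured_disc \<delta>" for z
  proof -
    show 1: "(F' has_field_derivative deriv F' z) (at z)"
      using holF'(1) open_punctured_disc z by (rule holomorphic_derivI)
    have zr: "z \<in> ball 0 r" using z sub\<delta> by blast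
    show 2: "(\<phi> has_field_derivative deriv \<phi> z) (at z)" using hol\<phi> open_ball zr by (rule holomorphic_derivI)
    have 3: "(\<eta> has_field_derivative deriv \<eta> z) (at z)" using hol\<eta> open_ball zr by (rule holomorphic_derivI)
    have "((\<lambda>z. b * F' z + \<alpha> * \<phi> z + \<eta> z) has_field_derivative (b * deriv F' z + \<alpha> * deriv \<phi> z + deriv \<eta> z)) (at z)"
      using 1 2 3 by (intro DERIV_add DERIV_cmult)
    then have "(G' has_field_derivative (b * deriv F' z + \<alpha> * deriv \<phi> z + deriv \<eta> z)) (at z)"
    proof (rule has_field_derivative_transform_within_open[OF _ open_punctured_disc z])
      fix w assume "w \<in> punctured_disc \<delta>"
      then have "w \<in> punctured_disc \<epsilon>" using sub\<delta> by blast
      then show "b * F' w + \<alpha> * \<phi> w + \<eta> w = G' w" by (simp add: G'F' \<eta>_def)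
    qed
    then show "deriv G' z = b * deriv F' z + \<alpha> * deriv \<phi> z + deriv \<eta> z" by (rule DERIV_imp_deriv)
  qed
  have F'\<eta>: "F' z * deriv \<eta> z = f' z * \<kappa> z" if "z \<in> punctured_disc \<delta>" for z
    using F'[of z] \<kappa>(2)[of z] that sub\<delta> by auto
  have dR': "(R' has_derivative (\<lambda>v. Re (F' z * deriv G' z * v))) (at z)" if "z \<in> punctured_disc \<delta>" for z
    using rep' that sub\<delta> unfolding affine_rep_def by blast
  have "Im \<alpha> = 0"
  proof (rule log_primitive_real[OF \<delta>(1)])
    fix z assume z: "z \<in> punctured_disc \<delta>"
    then have zr: "z \<in> ball 0 r" and zn: "z \<noteq> 0" using sub\<delta> by auto
    \<comment> \<open>\<open>F' dG'\<close> splits into \<open>b F' dF'\<close>,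
      \<open>\<alpha> d\<phi> / \<phi>\<close> and \<open>F' d\<eta>\<close>. Apart from \<alpha> dz
      / z everything has a single-valued primitive, which is subtracted here.\<close>
    have "((\<lambda>z. b / 2 * (F' z)\<^sup>2 + K z - \<alpha> * K2 z) has_field_derivative
        (b * F' z * deriv F' z + f' z * \<kappa> z - \<alpha> * (deriv f' z / f' z))) (at z)"
      by (auto intro!: derivative_eq_intros dF'[OF z] K[OF zr] K2[OF zr])
    note has_derivative_diff_Re[OF dR'[OF z] this]
    moreover have \<phi>F: "F' z * deriv \<phi> z = 1 / z - deriv f' z / f' z"
    proof -
      have \<phi>': "deriv \<phi> z = 1 / f' z - z * deriv f' z / (f' z)\<^sup>2" using d\<phi>[OF zr] by (rule DERIV_imp_deriv)
      have "z \<in> punctured_disc \<epsilon>" using z sub\<delta> by blast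
      then show ?thesis unfolding \<phi>' F'[OF \<open>z \<in> punctured_disc \<epsilon>\<close>] using nz[OF zr] zn
        by (simp add: field_simps power2_eq_square)
    qed
    have "F' z * deriv G' z - (b * F' z * deriv F' z + f' z * \<kappa> z - \<alpha> * (deriv f' z / f' z))
        = \<alpha> * (F' z * deriv \<phi> z + deriv f' z / f' z)"
      unfolding dG'[OF z] F'\<eta>[OF z, symmetric] by (simp add: algebra_simps)
    then have "F' z * deriv G' z - (b * F' z * deriv F' z + f' z * \<kappa> z - \<alpha> * (deriv f' z / f' z)) = \<alpha> / z"
      unfolding \<phi>F by simp
    ultimately show "((\<lambda>z. R' z - Re (b / 2 * (F' z)\<^sup>2 + K z - \<alpha> * K2 z)) has_derivative (\<lambda>v. Re (\<alpha> / z * v))) (at z)"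
      by (simp only:)
  qed
  define a where "a = Re \<alpha>"
  have a: "\<alpha> = of_real a" using \<open>Im \<alpha> = 0\<close> by (simp add: a_def complex_eq_iff)
  define Gm where "Gm = (\<lambda>z::complex. of_real a * z + b / z)"
  define Fm where "Fm = (\<lambda>z::complex. 1 / z)"
  obtain \<Psi> where front: "improper_affine_front (- {0}) Fm Gm \<Psi>"
    using model_front unfolding Fm_def Gm_def by blast
  obtain Rm where repm: "affine_rep (- {0}) Fm Gm \<Psi> Rm"
    using affine_rep_of_front[OF front] by blast
  have Gm\<phi>: "Gm (\<phi> z) = \<alpha> * \<phi> z + b * F' z" "Fm (\<phi> z) = F' z" if "z \<in> punctured_disc \<delta>" for z
    using \<phi>F'[OF that] unfolding Gm_def Fm_def a by (auto simp: divide_inverse)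
  have dGm: "(Gm has_field_derivative deriv Gm w) (at w)" if "w \<noteq> 0" for w
    using that unfolding Gm_def by (intro holomorphic_derivI[of _ "- {0}"] holomorphic_intros) auto
  have "((\<lambda>z. Rm (\<phi> z) + Re (K z)) has_derivative (\<lambda>v. Re (F' z * deriv G' z * v))) (at z)"
    if z: "z \<in> punctured_disc \<delta>" for z
  proof -
    have zr: "z \<in> ball 0 r" using z sub\<delta> by auto
    have "(Rm has_derivative (\<lambda>v. Re (Fm (\<phi> z) * deriv Gm (\<phi> z) * v))) (at (\<phi> z))"
      using repm \<phi>F'(2)[OF z] unfolding affine_rep_def by blast
    from has_derivative_compose[OF d\<phi>z[OF z, unfolded has_field_derivative_def] this]
    have "((\<lambda>z. Rm (\<phi> z)) has_derivative (\<lambda>v. Re (F' z * (deriv Gm (\<phi> z) * deriv \<phi> z) * v))) (at z)"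
      unfolding Gm\<phi>(2)[OF z] mult.assoc .
    note 1 = has_derivative_add_Re[OF this K[OF zr]]
    have "((\<lambda>z. \<alpha> * \<phi> z + b * F' z) has_field_derivative deriv Gm (\<phi> z) * deriv \<phi> z) (at z)"
      by (rule has_field_derivative_transform_within_open[OF _ open_punctured_disc z])
        (rule DERIV_chain2[OF dGm[OF \<phi>F'(2)[OF z]] d\<phi>z[OF z]], rule Gm\<phi>(1))
    moreover have "((\<lambda>z. \<alpha> * \<phi> z + b * F' z) has_field_derivative \<alpha> * deriv \<phi> z + b * deriv F' z) (at z)"
      using dF'[OF z] d\<phi>z[OF z] by (intro DERIV_add DERIV_cmult)
    ultimately have "deriv Gm (\<phi> z) * deriv \<phi> z = \<alpha> * deriv \<phi> z + b * deriv F' z"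
      by (rule DERIV_unique)
    then have "F' z * (deriv Gm (\<phi> z) * deriv \<phi> z) + f' z * \<kappa> z = F' z * deriv G' z"
      unfolding dG'[OF z] F'\<eta>[OF z, symmetric] by (simp add: algebra_simps)
    then show ?thesis using 1 by (simp only:)
  qed
  then obtain C where C: "\<And>z. z \<in> punctured_disc \<delta> \<Longrightarrow> R' z = Rm (\<phi> z) + Re (K z) + C"
    using has_derivative_eq_imp_constant_difference[OF connected_punctured_disc open_punctured_disc dR'] by blast
  \<comment> \<open>\<open>T\<close> undoes the translation by \<open>(2 cnj d, |d|^2)\<close> and
    adds \<open>- 2 (Re (K 0) + C)\<close>, the limit of
    \<open>- 2 (R' - Rm \<circ> \<phi>)\<close>.\<close>
  define T where "T = (\<lambda>(x::complex, t::real). (1 * x + - (2 * cnj d), t + (- (cmod d)\<^sup>2 - 2 * (Re (K 0) + C))))"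
  have T: "vertical_motion T"
    unfolding vertical_motion_def T_def
    by (intro exI[of _ 1] exI[of _ "- (2 * cnj d)"] exI[of _ "- (cmod d)\<^sup>2 - 2 * (Re (K 0) + C)"]) simp
  have diff: "\<psi> z - T (\<Psi> (\<phi> z)) =
     (\<eta> z, (cmod (\<eta> z))\<^sup>2 / 2 + Re (\<eta> z * cnj (\<alpha> * \<phi> z)) + Re (f' z * \<mu> z * cnj b * (cnj (F' z) / F' z)) + Re (f' z * \<mu> z) - 2 * (Re (K z) - Re (K 0)))"
    if z: "z \<in> punctured_disc \<delta>" for z
  proof -
    have z': "z \<in> punctured_disc \<epsilon>" using z sub\<delta> by blast
    have zn: "z \<noteq> 0" using z by simp
    define A where "A = Gm (\<phi> z)"
    have GA: "G' z = A + \<eta> z" unfolding A_def Gm\<phi>(1)[OF z] G'F'[OF z'] \<eta>_def by (simp add: algebra_simps)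
    have F0: "F' z \<noteq> 0" using \<phi>F'[OF z] by auto
    have \<eta>F: "\<eta> z * F' z = f' z * \<mu> z" using zn by (simp add: \<mu>(2) F'[OF z'])
    have "\<eta> z * cnj A = \<eta> z * cnj (\<alpha> * \<phi> z) + \<eta> z * F' z * cnj b * (cnj (F' z) / F' z)"
      unfolding A_def Gm\<phi>(1)[OF z] using F0 by (simp add: field_simps)
    then have \<eta>A: "\<eta> z * cnj A = \<eta> z * cnj (\<alpha> * \<phi> z) + f' z * \<mu> z * cnj b * (cnj (F' z) / F' z)"
      unfolding \<eta>F .
    have sq: "(cmod (A + \<eta> z))\<^sup>2 = (cmod A)\<^sup>2 + (cmod (\<eta> z))\<^sup>2 + 2 * Re (\<eta> z * cnj A)"
      unfolding cmod_power2 by (simp add: power2_eq_square algebra_simps)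
    have \<psi>: "\<psi> z + (2 * cnj d, (cmod d)\<^sup>2) = (A + \<eta> z + cnj (F' z),
       1/2 * ((cmod (A + \<eta> z))\<^sup>2 - (cmod (F' z))\<^sup>2) + Re ((A + \<eta> z) * F' z) - 2 * R' z)"
      using rep' z' unfolding affine_rep_def GA[symmetric] by blast
    have \<Psi>: "\<Psi> (\<phi> z) = (A + cnj (F' z), 1/2 * ((cmod A)\<^sup>2 - (cmod (F' z))\<^sup>2) + Re (A * F' z) - 2 * Rm (\<phi> z))"
      using repm \<phi>F'(2)[OF z] unfolding affine_rep_def A_def Gm\<phi>(2)[OF z, symmetric] by blast
    have "\<psi> z = (A + \<eta> z + cnj (F' z),
       1/2 * ((cmod (A + \<eta> z))\<^sup>2 - (cmod (F' z))\<^sup>2) + Re ((A + \<eta> z) * F' z) - 2 * R' z) - (2 * cnj d, (cmod d)\<^sup>2)"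
      unfolding \<psi>[symmetric] by simp
    then have "\<psi> z - T (\<Psi> (\<phi> z)) = (\<eta> z, (cmod (\<eta> z))\<^sup>2 / 2 + Re (\<eta> z * cnj A) + Re (\<eta> z * F' z) - 2 * (Re (K z) - Re (K 0)))"
      unfolding \<Psi> T_def sq C[OF z] by (simp add: algebra_simps add_divide_distrib diff_divide_distrib)
    then show ?thesis unfolding \<eta>F \<eta>A by simp
  qed
  have at: "eventually (\<lambda>z. z \<in> punctured_disc \<delta>) (at 0)"
    unfolding eventually_at using \<delta>(1) by (auto simp: dist_norm)
  have cont0: "(h \<longlongrightarrow> h 0) (at 0)" if "h holomorphic_on ball 0 r" for h
  proof -
    have "isCont h 0"
      using that r by (auto intro!: continuous_on_interior[of "ball 0 r"] holomorphic_on_imp_continuous_on)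
    then show ?thesis by (simp add: isCont_def)
  qed
  have f'r: "f' holomorphic_on ball 0 r" using holomorphic_on_subset[OF holf' subr] .
  have limK: "(K \<longlongrightarrow> K 0) (at 0)" using DERIV_isCont[OF K[of 0]] r by (simp add: isCont_def)
  have lim\<eta>: "(\<eta> \<longlongrightarrow> 0) (at 0)" using cont0[OF hol\<eta>] \<eta>0 by simp
  have lim\<mu>: "((\<lambda>z. f' z * \<mu> z) \<longlongrightarrow> 0) (at 0)"
    using tendsto_mult[OF cont0[OF f'r] cont0[OF \<mu>(1)]] \<mu>(3) by simp
  have lim\<phi>: "(\<phi> \<longlongrightarrow> 0) (at 0)" using cont0[OF hol\<phi>] by (simp add: \<phi>_def)
  \<comment> \<open>\<open>cnj F' / F'\<close> oscillates but has modulus at most 1, so the factor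
    \<open>f' \<mu>\<close> decides.\<close>
  have limb: "((\<lambda>z. f' z * \<mu> z * cnj b * (cnj (F' z) / F' z)) \<longlongrightarrow> 0) (at 0)"
  proof (rule Lim_null_comparison)
    show "eventually (\<lambda>z. cmod (f' z * \<mu> z * cnj b * (cnj (F' z) / F' z)) \<le> cmod (f' z * \<mu> z) * cmod b) (at 0)"
      by (intro always_eventually allI) (simp add: norm_mult norm_divide mult_left_le)
    show "((\<lambda>z. cmod (f' z * \<mu> z) * cmod b) \<longlongrightarrow> 0) (at 0)"
      using tendsto_mult_right[OF tendsto_norm[OF lim\<mu>], of "cmod b"] by simp
  qed
  have "((\<lambda>z. (\<eta> z, (cmod (\<eta> z))\<^sup>2 / 2 + Re (\<eta> z * cnj (\<alpha> * \<phi> z)) + Re (f' z * \<mu> z * cnj b * (cnj (F' z) / F' z)) + Re (f' z * \<mu> z) - 2 * (Re (K z) - Re (K 0))))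
      \<longlongrightarrow> (0, (cmod 0)\<^sup>2 / 2 + Re (0 * cnj (\<alpha> * 0)) + Re 0 + Re 0 - 2 * (Re (K 0) - Re (K 0)))) (at 0)"
    by (intro tendsto_intros lim\<eta> lim\<phi> limb lim\<mu> limK) auto
  then have "((\<lambda>z. \<psi> z - T (\<Psi> (\<phi> z))) \<longlongrightarrow> (0, (cmod 0)\<^sup>2 / 2 + Re (0 * cnj (\<alpha> * 0)) + Re 0 + Re 0 - 2 * (Re (K 0) - Re (K 0)))) (at 0)"
    by (rule Lim_transform_eventually) (use eventually_mono[OF at] diff in \<open>simp add: eventually_mono[OF at]\<close>)
  then have lim: "((\<lambda>z. norm (\<psi> z - T (\<Psi> (\<phi> z)))) \<longlongrightarrow> 0) (at 0)"
    by (auto intro: tendsto_norm_zero simp: zero_prod_def)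
  have "complete_at_0 \<delta> (Fm \<circ> \<phi>) (Gm \<circ> \<phi>)"
  proof (rule complete_at_0I)
    have \<phi>\<delta>: "\<phi> holomorphic_on punctured_disc \<delta>" using holomorphic_on_subset[OF hol\<phi> sub\<delta>(2)] .
    have img: "\<phi> ` punctured_disc \<delta> \<subseteq> - {0}" using \<phi>F'(2) by auto
    show "Fm \<circ> \<phi> holomorphic_on punctured_disc \<delta>" "Gm \<circ> \<phi> holomorphic_on punctured_disc \<delta>"
      unfolding Fm_def Gm_def by (auto intro!: holomorphic_on_compose_gen[OF \<phi>\<delta> _ img] holomorphic_intros)
    have "filterlim (\<lambda>z. inverse (cmod (\<phi> z))) at_top (at 0)"
    proof (rule filterlim_inverse_at_top)
      show "((\<lambda>z. cmod (\<phi> z)) \<longlongrightarrow> 0) (at 0)" using tendsto_norm[OF lim\<phi>] by simp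
      show "eventually (\<lambda>z. 0 < cmod (\<phi> z)) (at 0)" using eventually_mono[OF at] \<phi>F'(2) by simp
    qed
    \<comment> \<open>A lower bound for the horizontal part of the model:
      \<open>cnj (1 / \<phi>)\<close> outweighs \<open>b / \<phi>\<close> as |b| < 1, and
      \<open>\<alpha> \<phi>\<close> tends to 0.\<close>
    then have "filterlim (\<lambda>z. - (cmod \<alpha> * cmod (\<phi> z)) + (1 - cmod b) * inverse (cmod (\<phi> z))) at_top (at 0)"
      using b by (intro filterlim_tendsto_add_at_top[of _ "- (cmod \<alpha> * cmod 0)"] filterlim_tendsto_pos_mult_at_top[of "\<lambda>_. 1 - cmod b" "1 - cmod b"] tendsto_intros lim\<phi>) auto
    moreover have "eventually (\<lambda>z. - (cmod \<alpha> * cmod (\<phi> z)) + (1 - cmod b) * inverse (cmod (\<phi> z)) \<le> cmod ((Gm \<circ> \<phi>) z + cnj ((Fm \<circ> \<phi>) z))) (at 0)"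
    proof (rule eventually_mono[OF at])
      fix z assume z: "z \<in> punctured_disc \<delta>"
      have i: "inverse (cmod (\<phi> z)) = cmod (F' z)"
        unfolding \<phi>F'(1)[OF z, symmetric] by (simp add: norm_divide divide_inverse norm_inverse)
      have eq: "Gm (\<phi> z) + cnj (Fm (\<phi> z)) = cnj (F' z) - (- (\<alpha> * \<phi> z) - b * F' z)"
        unfolding Gm\<phi>[OF z] by simp
      have "cmod (cnj (F' z)) - cmod (- (\<alpha> * \<phi> z) - b * F' z) \<le> cmod (Gm (\<phi> z) + cnj (Fm (\<phi> z)))"
        unfolding eq by (rule norm_triangle_ineq2)
      moreover have "cmod (- (\<alpha> * \<phi> z) - b * F' z) \<le> cmod \<alpha> * cmod (\<phi> z) + cmod b * cmod (F' z)"
        using norm_triangle_ineq4[of "- (\<alpha> * \<phi> z)" "b * F' z"] by (simp add: norm_mult)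
      ultimately have "cmod (F' z) - (cmod \<alpha> * cmod (\<phi> z) + cmod b * cmod (F' z)) \<le> cmod (Gm (\<phi> z) + cnj (Fm (\<phi> z)))"
        unfolding complex_mod_cnj by linarith
      then show "- (cmod \<alpha> * cmod (\<phi> z)) + (1 - cmod b) * inverse (cmod (\<phi> z)) \<le> cmod ((Gm \<circ> \<phi>) z + cnj ((Fm \<circ> \<phi>) z))"
        unfolding i by (simp add: left_diff_distrib)
    qed
    ultimately show "filterlim (\<lambda>z. cmod ((Gm \<circ> \<phi>) z + cnj ((Fm \<circ> \<phi>) z))) at_top (at 0)"
      by (rule filterlim_at_top_mono)
  qed
  then have "asymptotic_to \<epsilon> \<psi> Fm Gm"
    unfolding asymptotic_to_def using front T \<delta> inj lim \<phi>F'(2) holomorphic_on_subset[OF hol\<phi> sub\<delta>(2)]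
    by (intro exI[of _ \<Psi>] exI[of _ T] exI[of _ \<delta>] exI[of _ \<phi>]) (auto simp del: punctured_disc_iff)
  then show ?thesis using that[of b a] b unfolding Fm_def Gm_def by blast
qed

section \<open>The characterization\<close>

text \<open>Only horizontal parts are compared. That of the model is at most a multiple of |\<phi>|
  + 1/|\<phi>|, and a motion changes its modulus by a bounded amount; that of \<open>\<psi>\<close>
  is at least (|f| - |g|) / |z|^n.\<close>

lemma asymptotic_end_simple:
  assumes \<epsilon>: "\<epsilon> > 0" and f: "f holomorphic_on ball 0 \<epsilon>" and g: "g holomorphic_on ball 0 \<epsilon>"
    and fg: "cmod (g 0) < cmod (f 0)"
    and \<psi>: "\<And>z. z \<in> punctured_disc \<epsilon> \<Longrightarrow> fst (\<psi> z) = g z / z ^ n + cnj (f z / z ^ n)"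
    and asym: "asymptotic_to \<epsilon> \<psi> (\<lambda>z. 1 / z) (\<lambda>z. of_real a * z + b / z)"
  shows "n \<le> 1"
proof (rule ccontr)
  assume "\<not> n \<le> 1"
  then have "2 \<le> n" by simp
  then obtain j where j: "n = Suc (Suc j)" by (metis add_2_eq_Suc le_Suc_ex)
  define Gm where "Gm = (\<lambda>z::complex. of_real a * z + b / z)"
  obtain \<Psi> T \<delta> \<phi> where front: "improper_affine_front (- {0}) (\<lambda>z. 1 / z) Gm \<Psi>" and T: "vertical_motion T"
    and \<delta>: "0 < \<delta>" "\<delta> \<le> \<epsilon>" and hol: "\<phi> holomorphic_on punctured_disc \<delta>" and inj: "inj_on \<phi> (punctured_disc \<delta>)"
    and img: "\<phi> ` punctured_disc \<delta> \<subseteq> - {0}"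
    and lim: "((\<lambda>z. norm (\<psi> z - T (\<Psi> (\<phi> z)))) \<longlongrightarrow> 0) (at 0)"
    using asym unfolding asymptotic_to_def Gm_def[symmetric] by blast
  obtain Rm where repm: "affine_rep (- {0}) (\<lambda>z. 1 / z) Gm \<Psi> Rm"
    using affine_rep_of_front[OF front] by blast
  have nz: "\<phi> z \<noteq> 0" if "z \<in> punctured_disc \<delta>" for z using img that by blast
  obtain C1 where C1: "eventually (\<lambda>z. cmod (\<phi> z) * cmod z \<le> C1) (at 0)"
    using injective_at_0_bound[OF hol inj \<delta>(1)] by blast
  have "(\<lambda>z. 1 / \<phi> z) holomorphic_on punctured_disc \<delta>" using hol nz by (intro holomorphic_intros) auto
  moreover have "inj_on (\<lambda>z. 1 / \<phi> z) (punctured_disc \<delta>)"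
    using inj nz by (auto simp: inj_on_def)
  ultimately obtain C2 where C2: "eventually (\<lambda>z. cmod (1 / \<phi> z) * cmod z \<le> C2) (at 0)"
    using injective_at_0_bound[of "\<lambda>z. 1 / \<phi> z" \<delta>] \<delta>(1) by blast
  obtain v where v: "cmod (fst (T p)) \<le> cmod (fst p) + cmod v" for p
  proof -
    obtain u v c where uv: "cmod u = 1"
      "T = (\<lambda>(x, t). (u * x + v, t + c)) \<or> T = (\<lambda>(x, t). (u * cnj x + v, - t + c))"
      using T unfolding vertical_motion_def by blast
    have "cmod (fst (T p)) \<le> cmod (fst p) + cmod v" for p
    proof -
      have "fst (T p) = u * fst p + v \<or> fst (T p) = u * cnj (fst p) + v"
        using uv(2) by (auto split: prod.splits)
      moreover have "cmod (u * fst p) = cmod (fst p)" "cmod (u * cnj (fst p)) = cmod (fst p)"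
        using uv(1) by (simp_all add: norm_mult)
      ultimately show ?thesis using norm_triangle_ineq by metis
    qed
    then show ?thesis using that by blast
  qed
  have at: "eventually (\<lambda>z. z \<in> punctured_disc \<delta>) (at 0)"
    unfolding eventually_at using \<delta>(1) by (auto simp: dist_norm)
  have small: "eventually (\<lambda>z. norm (\<psi> z - T (\<Psi> (\<phi> z))) < 1) (at 0)"
    using lim by (rule order_tendstoD) simp
  \<comment> \<open>The last summand accounts for the translation in \<open>T\<close> and for the
    distance to the model, which is below 1, both multiplied by |z| < \<delta>.\<close>
  define C where "C = \<bar>a\<bar> * C1 + (cmod b + 1) * C2 + (cmod v + 1) * \<delta>"
  have bound: "eventually (\<lambda>z. cmod (g z / z ^ n + cnj (f z / z ^ n)) * cmod z \<le> C) (at 0)"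
    using at small C1 C2
  proof eventually_elim
    case (elim z)
    have z: "z \<in> punctured_disc \<epsilon>" using elim(1) \<delta> by auto
    have "fst (\<Psi> (\<phi> z)) = of_real a * \<phi> z + b / \<phi> z + cnj (1 / \<phi> z)"
      using repm nz[OF elim(1)] unfolding affine_rep_def Gm_def by auto
    also have "cmod \<dots> \<le> cmod (of_real a * \<phi> z) + cmod (b / \<phi> z) + cmod (cnj (1 / \<phi> z))"
      using norm_triangle_ineq order_trans add_right_mono by meson
    finally have 1: "cmod (fst (\<Psi> (\<phi> z))) \<le> \<bar>a\<bar> * cmod (\<phi> z) + (cmod b + 1) * cmod (1 / \<phi> z)"
      unfolding complex_mod_cnj by (simp add: norm_mult norm_divide add_divide_distrib)
    have "cmod (fst (\<psi> z) - fst (T (\<Psi> (\<phi> z)))) \<le> norm (\<psi> z - T (\<Psi> (\<phi> z)))"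
      by (metis norm_fst_le fst_diff prod.collapse)
    then have "cmod (fst (\<psi> z)) \<le> cmod (fst (T (\<Psi> (\<phi> z)))) + 1"
      using elim(2) norm_triangle_sub[of "fst (\<psi> z)" "fst (T (\<Psi> (\<phi> z)))"] by linarith
    also have "\<dots> \<le> \<bar>a\<bar> * cmod (\<phi> z) + (cmod b + 1) * cmod (1 / \<phi> z) + (cmod v + 1)"
      using v[of "\<Psi> (\<phi> z)"] 1 by linarith
    finally have "cmod (fst (\<psi> z)) * cmod z \<le> (\<bar>a\<bar> * cmod (\<phi> z) + (cmod b + 1) * cmod (1 / \<phi> z) + (cmod v + 1)) * cmod z"
      by (intro mult_right_mono) auto
    also have "\<dots> = \<bar>a\<bar> * (cmod (\<phi> z) * cmod z) + (cmod b + 1) * (cmod (1 / \<phi> z) * cmod z) + (cmod v + 1) * cmod z"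
      by (simp only: distrib_right mult.assoc)
    also have "\<dots> \<le> C"
      unfolding C_def using elim by (intro add_mono mult_left_mono) auto
    finally show ?case using \<psi>[OF z] by simp
  qed
  \<comment> \<open>With \<open>n = j + 2\<close> a positive power of |z| is left on the right, so
    the limit yields |f(0)| \<le> |g(0)|.\<close>
  have lower: "eventually (\<lambda>z. cmod (f z) - cmod (g z) \<le> C * cmod z ^ Suc j) (at 0)"
    using at bound
  proof eventually_elim
    case (elim z)
    have z: "z \<noteq> 0" using elim(1) by simp
    have "cmod (cnj (f z / z ^ n)) - cmod (- (g z / z ^ n)) \<le> cmod (cnj (f z / z ^ n) - - (g z / z ^ n))"
      by (rule norm_triangle_ineq2)
    also have "cnj (f z / z ^ n) - - (g z / z ^ n) = g z / z ^ n + cnj (f z / z ^ n)" by simp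
    finally have "(cmod (f z) - cmod (g z)) / cmod z ^ n \<le> cmod (g z / z ^ n + cnj (f z / z ^ n))"
      unfolding complex_mod_cnj norm_minus_cancel by (simp add: norm_divide norm_power diff_divide_distrib)
    then have "(cmod (f z) - cmod (g z)) / cmod z ^ n * cmod z \<le> C"
      using elim(2) mult_right_mono[OF _ norm_ge_zero[of z]] order_trans by blast
    then have "(cmod (f z) - cmod (g z)) / cmod z ^ Suc j \<le> C"
      using z by (simp add: j)
    then show ?case using z by (simp add: divide_le_eq)
  qed
  have cont: "(h \<longlongrightarrow> h 0) (at 0)" if "h holomorphic_on ball 0 \<epsilon>" for h
  proof -
    have "isCont h 0"
      using that \<epsilon> by (auto intro!: continuous_on_interior[of "ball 0 \<epsilon>"] holomorphic_on_imp_continuous_on)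
    then show ?thesis by (simp add: isCont_def)
  qed
  have "cmod (f 0) - cmod (g 0) \<le> C * cmod 0 ^ Suc j"
  proof (rule tendsto_le[OF _ _ _ lower])
    show "((\<lambda>z. C * cmod z ^ Suc j) \<longlongrightarrow> C * cmod 0 ^ Suc j) (at 0)"
      by (intro tendsto_intros)
    show "((\<lambda>z. cmod (f z) - cmod (g z)) \<longlongrightarrow> cmod (f 0) - cmod (g 0)) (at 0)"
      by (intro tendsto_intros cont f g)
  qed simp
  then show False using fg by simp
qed

lemma dominated_end:
  assumes \<epsilon>: "\<epsilon> > 0" and holF: "F holomorphic_on punctured_disc \<epsilon>" and holG: "G holomorphic_on punctured_disc \<epsilon>"
    and mer: "F meromorphic_on {0}" "G meromorphic_on {0}"
    and lt: "\<And>z. z \<in> punctured_disc \<epsilon> \<Longrightarrow> cmod (deriv G z) < cmod (deriv F z)"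
    and complete: "complete_at_0 \<epsilon> F G"
    and rep: "affine_rep (punctured_disc \<epsilon>) F G \<psi> R"
  shows "embedded_end \<epsilon> \<psi> \<longleftrightarrow>
      (\<exists>(a::real) b. cmod b \<noteq> 1 \<and> asymptotic_to \<epsilon> \<psi> (\<lambda>z. 1 / z) (\<lambda>z. of_real a * z + b / z))"
proof -
  obtain n f g where n: "n \<ge> 1" and f: "f holomorphic_on ball 0 \<epsilon>" and g: "g holomorphic_on ball 0 \<epsilon>"
    and F: "\<And>z. z \<in> punctured_disc \<epsilon> \<Longrightarrow> F z = f z / z ^ n" and G: "\<And>z. z \<in> punctured_disc \<epsilon> \<Longrightarrow> G z = g z / z ^ n"
    and fg: "cmod (g 0) < cmod (f 0)"
    using end_normal_form[OF \<epsilon> holF holG mer lt complete] by blast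
  have fst\<psi>: "fst (\<psi> z) = g z / z ^ n + cnj (f z / z ^ n)" if "z \<in> punctured_disc \<epsilon>" for z
    using rep that unfolding affine_rep_def by (auto simp: F G)
  have "n = 1" if emb: "embedded_end \<epsilon> \<psi>"
  proof (rule ccontr)
    assume "n \<noteq> 1"
    then have n2: "n \<ge> 2" using n by simp
    obtain U where U: "open U" "0 \<in> U" "embedding_map (top_of_set (U - {0})) euclidean \<psi>"
      using emb unfolding embedded_end_def by (elim exE conjE)
    obtain s where s: "s > 0" "ball 0 s \<subseteq> U" using U open_contains_ball by blast
    \<comment> \<open>Self-intersections occur in arbitrarily small punctured discs, so one inside
      \<open>U\<close> is taken.\<close>
    define r where "r = min s \<epsilon>"
    have r: "r > 0" "r \<le> \<epsilon>" "r \<le> s" using s \<epsilon> by (auto simp: r_def)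
    have sub: "punctured_disc r \<subseteq> punctured_disc \<epsilon>" "ball 0 r \<subseteq> ball (0::complex) \<epsilon>" "punctured_disc r \<subseteq> U - {0}"
      using r s by (auto simp: subset_iff)
    have "inj_on \<psi> (U - {0})"
      using U(3) unfolding embedding_map_def homeomorphic_eq_everything_map by simp
    moreover have "continuous_on (punctured_disc r) \<psi>"
    proof (intro continuous_at_imp_continuous_on ballI)
      fix z assume "z \<in> punctured_disc r"
      then have "z \<in> punctured_disc \<epsilon>" using sub by blast
      then obtain D where "(\<psi> has_derivative D) (at z)"
        using affine_rep_has_derivative[OF rep open_punctured_disc holF holG] by blast
      then show "isCont \<psi> z" by (rule has_derivative_continuous)
    qed
    ultimately show False
      using not_injective_multiple_end[OF n2 r(1) holomorphic_on_subset[OF f sub(2)] holomorphic_on_subset[OF g sub(2)] fg, of \<psi>]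
        fst\<psi> sub inj_on_subset by blast
  qed
  moreover have "n = 1" if "asymptotic_to \<epsilon> \<psi> (\<lambda>z. 1 / z) (\<lambda>z. of_real a * z + b / z)" for a :: real and b
    using asymptotic_end_simple[OF \<epsilon> f g fg fst\<psi> that] n by simp
  moreover have "embedded_end \<epsilon> \<psi> \<and> (\<exists>(a::real) b. cmod b \<noteq> 1 \<and> asymptotic_to \<epsilon> \<psi> (\<lambda>z. 1 / z) (\<lambda>z. of_real a * z + b / z))"
    if "n = 1"
  proof
    have F1: "\<And>z. z \<in> punctured_disc \<epsilon> \<Longrightarrow> F z = f z / z" and G1: "\<And>z. z \<in> punctured_disc \<epsilon> \<Longrightarrow> G z = g z / z"
      using F G that by simp_all
    show "embedded_end \<epsilon> \<psi>"
      by (rule simple_end_embedded[OF \<epsilon> holF holG f g F1 G1 fg lt rep])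
    obtain a :: real and b where "cmod b < 1" "asymptotic_to \<epsilon> \<psi> (\<lambda>z. 1 / z) (\<lambda>z. of_real a * z + b / z)"
      using simple_end_asymptotic[OF \<epsilon> holF holG f g F1 G1 fg rep] by blast
    then show "\<exists>(a::real) b. cmod b \<noteq> 1 \<and> asymptotic_to \<epsilon> \<psi> (\<lambda>z. 1 / z) (\<lambda>z. of_real a * z + b / z)"
      by (metis less_irrefl)
  qed
  ultimately show ?thesis by blast
qed

section \<open>Symmetry under the half-turn and conclusion\<close>

lemma embedded_end_flip:
  assumes "embedded_end \<epsilon> \<psi>"
  shows "embedded_end \<epsilon> (flip \<circ> \<psi>)"
proof -
  obtain U where U: "open U" "0 \<in> U" "U \<subseteq> ball 0 \<epsilon>" "embedding_map (top_of_set (U - {0})) euclidean \<psi>"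
    "\<And>z. z \<in> U - {0} \<Longrightarrow> \<exists>D. (\<psi> has_derivative D) (at z) \<and> inj D"
    using assms unfolding embedded_end_def by blast
  have inj: "inj flip" by (metis flip_simps(2) injI)
  have cont: "continuous_map euclidean euclidean flip"
    using bounded_linear_flip by (simp add: linear_continuous_on)
  then have "homeomorphic_map euclidean euclidean flip"
    unfolding homeomorphic_map_maps homeomorphic_maps_def by (intro exI[of _ flip]) auto
  then have "embedding_map euclidean euclidean flip"
    using surjective_embedding_map by blast
  then have "embedding_map (top_of_set (U - {0})) euclidean (flip \<circ> \<psi>)"
    using U(4) embedding_map_compose by blast
  moreover have "\<exists>D. (flip \<circ> \<psi> has_derivative D) (at z) \<and> inj D" if z: "z \<in> U - {0}" for z
  proof -
    obtain D where D: "(\<psi> has_derivative D) (at z)" "inj D" using U(5)[OF z] by blast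
    have "(flip \<circ> \<psi> has_derivative flip \<circ> D) (at z)"
      unfolding o_def using bounded_linear.has_derivative[OF bounded_linear_flip D(1)] .
    then show ?thesis using inj_compose[OF inj D(2)] by blast
  qed
  ultimately show ?thesis
    unfolding embedded_end_def using U by blast
qed

text \<open>The model data stay as they are: the half-turn is absorbed into the motion, since
  composing with \<open>flip\<close> interchanges the two forms of a vertical motion.\<close>

lemma asymptotic_to_flip:
  assumes "asymptotic_to \<epsilon> \<psi> F G"
  shows "asymptotic_to \<epsilon> (flip \<circ> \<psi>) F G"
proof -
  obtain \<Psi> T \<delta> \<phi> where *: "improper_affine_front (- {0}) F G \<Psi>" "vertical_motion T"
    "0 < \<delta>" "\<delta> \<le> \<epsilon>" "\<phi> holomorphic_on punctured_disc \<delta>" "inj_on \<phi> (punctured_disc \<delta>)"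
    "\<phi> ` punctured_disc \<delta> \<subseteq> - {0}" "complete_at_0 \<delta> (F \<circ> \<phi>) (G \<circ> \<phi>)"
    "((\<lambda>z. norm (\<psi> z - T (\<Psi> (\<phi> z)))) \<longlongrightarrow> 0) (at 0)"
    using assms unfolding asymptotic_to_def by blast
  have nf: "norm (flip p - flip q) = norm (p - q)" for p q
  proof -
    have "flip p - flip q = flip (p - q)"
      using linear_diff[OF bounded_linear.linear[OF bounded_linear_flip]] by simp
    also have "norm \<dots> = norm (p - q)" by (cases "p - q") (simp add: norm_Pair)
    finally show ?thesis .
  qed
  have "vertical_motion (flip \<circ> T)"
  proof -
    obtain u v c where u: "cmod u = 1"
      and T: "T = (\<lambda>(x, t). (u * x + v, t + c)) \<or> T = (\<lambda>(x, t). (u * cnj x + v, - t + c))"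
      using *(2) unfolding vertical_motion_def by blast
    have "flip \<circ> T = (\<lambda>(x, t). (cnj u * x + cnj v, t + - c)) \<or> flip \<circ> T = (\<lambda>(x, t). (cnj u * cnj x + cnj v, - t + - c))"
      using T by (auto simp: fun_eq_iff flip_def)
    then show ?thesis
      unfolding vertical_motion_def using u by (intro exI[of _ "cnj u"] exI[of _ "cnj v"] exI[of _ "- c"]) auto
  qed
  moreover have "((\<lambda>z. norm ((flip \<circ> \<psi>) z - (flip \<circ> T) (\<Psi> (\<phi> z)))) \<longlongrightarrow> 0) (at 0)"
    using *(9) by (simp add: nf)
  ultimately show ?thesis unfolding asymptotic_to_def using * by blast
qed

theorem theorem3p2:
  fixes \<epsilon> :: real and F G :: "complex \<Rightarrow> complex" and \<psi> :: "complex \<Rightarrow> complex \<times> real"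
  assumes "\<epsilon> > 0"
    and "improper_affine_sphere (punctured_disc \<epsilon>) F G \<psi>"
    and "F meromorphic_on {0}" and "G meromorphic_on {0}"
    and "complete_at_0 \<epsilon> F G"
  shows "embedded_end \<epsilon> \<psi> \<longleftrightarrow>
         asymptotic_to_P \<epsilon> \<psi> \<or> asymptotic_to_R \<epsilon> \<psi> \<or> asymptotic_to_NR \<epsilon> \<psi>"
proof -
  let ?S = "punctured_disc \<epsilon>"
  let ?asym = "\<lambda>\<psi>. \<exists>(a::real) b. cmod b \<noteq> 1 \<and> asymptotic_to \<epsilon> \<psi> (\<lambda>z. 1 / z) (\<lambda>z. of_real a * z + b / z)"
  have front: "improper_affine_front ?S F G \<psi>" and ne: "\<And>z. z \<in> ?S \<Longrightarrow> cmod (deriv F z) \<noteq> cmod (deriv G z)"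
    using assms(2) unfolding improper_affine_sphere_def by auto
  have hol: "F holomorphic_on ?S" "G holomorphic_on ?S"
    using front unfolding improper_affine_front_def by auto
  obtain R where rep: "affine_rep ?S F G \<psi> R" using affine_rep_of_front[OF front] by blast
  \<comment> \<open>|F'| - |G'| has no zero on the connected punctured disc, so one derivative
    dominates throughout.\<close>
  have "continuous_on ?S (\<lambda>z. cmod (deriv F z) - cmod (deriv G z))"
    using hol by (intro continuous_intros holomorphic_on_imp_continuous_on holomorphic_deriv open_punctured_disc)
  then have "connected ((\<lambda>z. cmod (deriv F z) - cmod (deriv G z)) ` ?S)"
    by (rule connected_continuous_image[OF _ connected_punctured_disc])
  then have "\<not> (\<exists>z\<in>?S. \<exists>w\<in>?S. cmod (deriv F z) < cmod (deriv G z) \<and> cmod (deriv G w) < cmod (deriv F w))"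
  proof (intro notI, elim bexE conjE)
    fix z w assume zw: "z \<in> ?S" "w \<in> ?S" "cmod (deriv F z) < cmod (deriv G z)" "cmod (deriv G w) < cmod (deriv F w)"
    have "0 \<in> (\<lambda>z. cmod (deriv F z) - cmod (deriv G z)) ` ?S"
      by (rule connectedD_interval[OF \<open>connected _\<close> imageI[OF zw(1)] imageI[OF zw(2)]]) (use zw in auto)
    then show False using ne by (auto simp del: punctured_disc_iff)
  qed
  then consider "\<And>z. z \<in> ?S \<Longrightarrow> cmod (deriv G z) < cmod (deriv F z)" | "\<And>z. z \<in> ?S \<Longrightarrow> cmod (deriv F z) < cmod (deriv G z)"
    using ne by (metis linorder_neqE_linordered_idom)
  then have "embedded_end \<epsilon> \<psi> \<longleftrightarrow> ?asym \<psi>"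
  proof cases
    case 1
    then show ?thesis by (rule dominated_end[OF assms(1) hol assms(3,4) _ assms(5) rep])
  next
    case 2
    \<comment> \<open>\<open>flip\<close> is an involution, so the implications from
      \<open>\<psi>\<close> to \<open>flip \<circ> \<psi>\<close> can be reversed.\<close>
    have ff: "flip \<circ> (flip \<circ> \<psi>) = \<psi>" by (simp add: fun_eq_iff)
    have "embedded_end \<epsilon> (flip \<circ> \<psi>) \<longleftrightarrow> ?asym (flip \<circ> \<psi>)"
      by (rule dominated_end[OF assms(1) hol(2,1) assms(4,3) 2 _ affine_rep_flip[OF rep open_punctured_disc hol]])
        (use assms(5) complete_at_0_commute in auto)
    then show ?thesis
      using embedded_end_flip asymptotic_to_flip ff by metis
  qed
  also have "?asym \<psi> \<longleftrightarrow> asymptotic_to_P \<epsilon> \<psi> \<or> asymptotic_to_R \<epsilon> \<psi> \<or> asymptotic_to_NR \<epsilon> \<psi>"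
  proof
    assume "?asym \<psi>"
    then obtain a :: real and b where b: "cmod b \<noteq> 1" "asymptotic_to \<epsilon> \<psi> (\<lambda>z. 1 / z) (\<lambda>z. of_real a * z + b / z)"
      by blast
    \<comment> \<open>For \<open>a = 0\<close> the value \<open>b = 0\<close> is included, as type P
      admits it.\<close>
    consider "a = 0" | "a \<noteq> 0" "b = 0" | "a \<noteq> 0" "b \<noteq> 0" by blast
    then show "asymptotic_to_P \<epsilon> \<psi> \<or> asymptotic_to_R \<epsilon> \<psi> \<or> asymptotic_to_NR \<epsilon> \<psi>"
    proof cases
      case 1
      then show ?thesis using b unfolding asymptotic_to_P_def by auto
    next
      case 2
      then show ?thesis using b unfolding asymptotic_to_R_def by auto
    next
      case 3
      then show ?thesis using b unfolding asymptotic_to_NR_def by blast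
    qed
  next
    assume "asymptotic_to_P \<epsilon> \<psi> \<or> asymptotic_to_R \<epsilon> \<psi> \<or> asymptotic_to_NR \<epsilon> \<psi>"
    then show "?asym \<psi>"
    proof (elim disjE)
      assume "asymptotic_to_P \<epsilon> \<psi>"
      then obtain b where "cmod b \<noteq> 1" "asymptotic_to \<epsilon> \<psi> (\<lambda>z. 1 / z) (\<lambda>z. b / z)"
        unfolding asymptotic_to_P_def by blast
      then show ?thesis by (intro exI[of _ 0] exI[of _ b]) simp
    next
      assume "asymptotic_to_R \<epsilon> \<psi>"
      then obtain a :: real where "asymptotic_to \<epsilon> \<psi> (\<lambda>z. 1 / z) (\<lambda>z. of_real a * z)"
        unfolding asymptotic_to_R_def by blast
      then show ?thesis by (intro exI[of _ a] exI[of _ 0]) simp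
    next
      assume "asymptotic_to_NR \<epsilon> \<psi>"
      then show ?thesis unfolding asymptotic_to_NR_def by blast
    qed
  qed
  finally show ?thesis .
qed

end
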